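(* The set $\mathrm{Ineq}_{meca}=\mathcal{I}'\backslash\mathrm{Rev}_{meca}/\mathcal{L}$ of mechanically inequivalent states of the Rubik's Revenge satisfies $\#\mathrm{Ineq}_{meca}=3$.
   Context: $C_n=\mathbf{Z}/n\mathbf{Z}$; $\mathfrak{S}(X)$ is the group of permutations of a set $X$. Geometric pieces. Model the $4\times4\times4$ cube by the 56 cubies $c\in\{-3,-1,1,3\}^3$ having at least one coordinate equal to $\pm3$. A (geometric) facet is a pair $(c,n)$ with $c$ a cubie and $n\in\{\pm e_1,\pm e_2,\pm e_3\}$ such that $\langle c,n\rangle=3$; put $p(c,n)=c$. $\mathrm{ArGeom}$ (24 edges), $\mathrm{SomGeom}$ (8 corners), $\mathrm{CentGeom}$ (24 centres) are the sets of cubies with exactly two, three, one coordinates equal to $\pm3$. $C_2$ acts on the facets of edges by exchanging the two facets of each edge; the generator of $C_3$ acts on the three facets of each corner $c$ by the direct rotation of angle $2\pi/3$ about the axis oriented from $c$ to the origin. Material pieces. $\mathrm{Coul}=\{\mathrm{Bla},\mathrm{J},\mathrm{Ble},\mathrm{V},\mathrm{O},\mathrm{R}\}$, with opposite pairs $\{\mathrm{Bla},\mathrm{J}\},\{\mathrm{Ble},\mathrm{V}\},\{\mathrm{O},\mathrm{R}\}$. $\mathrm{ArMat}$ is the set of pairs $(P,j)$, $P$ one of the 12 pairs of non-opposite distinct colours, $j\in\{1,2\}$; its facets are $(P,j,c)$, $c\in P$, and $C_2$ exchanges the two facets of each material edge. $\mathrm{SomMat}$ is the set of the 8 triples of pairwise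 non-opposite distinct colours, the facets of a triple being its colours, with the generator of $C_3$ acting by the cyclic permutations $[\mathrm{Bla},\mathrm{Ble},\mathrm{R}]$, $[\mathrm{Bla},\mathrm{O},\mathrm{Ble}]$, $[\mathrm{Bla},\mathrm{V},\mathrm{O}]$, $[\mathrm{Bla},\mathrm{R},\mathrm{V}]$, $[\mathrm{J},\mathrm{R},\mathrm{Ble}]$, $[\mathrm{J},\mathrm{Ble},\mathrm{O}]$, $[\mathrm{J},\mathrm{V},\mathrm{R}]$, $[\mathrm{J},\mathrm{O},\mathrm{V}]$ ($[a,b,c]$ meaning $a\mapsto b\mapsto c\mapsto a$). $\mathrm{CentMat}=\mathrm{Coul}\times\{1,2,3,4\}$, each having one facet. Colourings. An isomorphism of $C_k$-bundles between two such sets of pieces is a pair $(f,F)$ with $f$ a bijection of pieces and $F$ a $C_k$-equivariant bijection of facets lying over $f$ (a facet of a piece $a$ is sent to a facet of $f(a)$). $\mathrm{Rev}_{marq}$ is the set of triples $(\mathfrak{f},\mathfrak{g},h)$ where $\mathfrak{f}:\mathrm{ArGeom}\to\mathrm{ArMat}$ is an isomorphism of $C_2$-bundles, $\mathfrak{g}:\mathrm{SomGeom}\to\mathrm{SomMat}$ is an isomorphism of $C_3$-bundles and $h:\mathrm{CentGeom}\to\mathrm{CentMat}$ is a bijection. Let $\mathcal{T}_{geom}=\mathrm{Aut}_{C_2}(\mathrm{ArGeom})\times\mathrm{Aut}_{C_3}(\mathrm{SomGeom})\times\mathfrak{S}(\mathrm{CentGeom})$ and $\mathcal{T}_{mat}=\mathrm{Aut}_{C_2}(\mathrm{ArMat})\times\mathrm{Aut}_{C_3}(\mathrm{SomMat})\times\mathfrak{S}(\mathrm{CentMat})$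 (bundle automorphisms). $\mathcal{T}_{mat}$ acts on the left and $\mathcal{T}_{geom}$ on the right of $\mathrm{Rev}_{marq}$ by composition. Legal moves. For $i\in\{1,2,3\}$ and $v\in\{-3,-1,1,3\}$, the elementary slice move is the permutation of the facets sending $(c,n)$ to $(Rc,Rn)$ if $c_i=v$ and fixing $(c,n)$ otherwise, where $R$ is the rotation by a quarter turn about the axis $e_i$. These 12 moves define elements of $\mathcal{T}_{geom}$; $\mathcal{L}\subset\mathcal{T}_{geom}$ is the subgroup they generate. Indistinguishable transformations. $\mathcal{I}=\mathcal{I}(\mathrm{ArMat})\times\{1\}\times\mathcal{I}(\mathrm{CentMat})\subset\mathcal{T}_{mat}$, where $\mathcal{I}(\mathrm{ArMat})$ is the group of $C_2$-bundle automorphisms of $\mathrm{ArMat}$ whose map on facets preserves the colour of each facet and the colour pair of each edge (i.e. $(P,j,c)\mapsto(P,j',c)$), and $\mathcal{I}(\mathrm{CentMat})$ is the group of permutations of $\mathrm{CentMat}$ preserving the colour. Solved state. Put $\mathrm{col}(e_1)=\mathrm{R}$, $\mathrm{col}(-e_1)=\mathrm{O}$, $\mathrm{col}(e_2)=\mathrm{Ble}$, $\mathrm{col}(-e_2)=\mathrm{V}$, $\mathrm{col}(e_3)=\mathrm{Bla}$, $\mathrm{col}(-e_3)=\mathrm{J}$. The solved state $x_0=(\mathfrak{f},\mathfrak{g},h)\in\mathrm{Rev}_{marq}$ is a fixed element sending each facet $(c,n)$ to a material facet of colour $\mathrm{col}(n)$. Mechanical constraints. For an edge $c\in\mathrm{ArGeom}$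 with facets $(c,n),(c,n')$ and remaining coordinate $c_k=\pm1$, let $s(c)$ be the facet $(c,n)$ for the ordering with $\det(n,n',c_ke_k)>0$. $\mathcal{T}'_{geom}$ is the subgroup of $((\sigma,\Phi),(\tau,\Psi),\phi)\in\mathcal{T}_{geom}$ such that $\Phi(s(\alpha))=s(\sigma(\alpha))$ for all $\alpha\in\mathrm{ArGeom}$ (one has $\mathcal{L}\subset\mathcal{T}'_{geom}$). $\mathrm{Rev}_{meca}=x_0\cdot\mathcal{T}'_{geom}$ and $\mathcal{I}'=\mathcal{I}\cap x_0\mathcal{T}'_{geom}x_0^{-1}$. $\mathcal{I}'\backslash\mathrm{Rev}_{meca}/\mathcal{L}$ is the set of double orbits $\mathcal{I}'\cdot x\cdot\mathcal{L}$, $x\in\mathrm{Rev}_{meca}$. *)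

theory Defs
  imports "HOL-Algebra.Algebra" "HOL-Combinatorics.Cycles" "HOL-Library.Product_Plus"
begin

section \<open>Integer vectors\<close>

type_synonym vec = "int \<times> int \<times> int"

datatype axis = E1 | E2 | E3

fun coord :: "axis \<Rightarrow> vec \<Rightarrow> int" where
  "coord E1 (x, y, z) = x"
| "coord E2 (x, y, z) = y"
| "coord E3 (x, y, z) = z"

fun basis :: "axis \<Rightarrow> vec" where
  "basis E1 = (1, 0, 0)"
| "basis E2 = (0, 1, 0)"
| "basis E3 = (0, 0, 1)"

fun smul :: "int \<Rightarrow> vec \<Rightarrow> vec" where
  "smul k (x, y, z) = (k * x, k * y, k * z)"

fun vdiv :: "vec \<Rightarrow> int \<Rightarrow> vec" where
  "vdiv (x, y, z) k = (x div k, y div k, z div k)"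

fun dot :: "vec \<Rightarrow> vec \<Rightarrow> int" where
  "dot (x, y, z) (x', y', z') = x * x' + y * y' + z * z'"

fun cross :: "vec \<Rightarrow> vec \<Rightarrow> vec" where
  "cross (x, y, z) (x', y', z') = (y * z' - z * y', z * x' - x * z', x * y' - y * x')"

definition det3 :: "vec \<Rightarrow> vec \<Rightarrow> vec \<Rightarrow> int" where
  "det3 u v w = dot u (cross v w)"

fun quarter_turn :: "axis \<Rightarrow> vec \<Rightarrow> vec" where
  "quarter_turn E1 (x, y, z) = (x, - z, y)"
| "quarter_turn E2 (x, y, z) = (z, y, - x)"
| "quarter_turn E3 (x, y, z) = (- y, x, z)"


section \<open>Bundles of pieces\<close>

text \<open>A bundle consists of pieces, facets, the projection of a facet to its piece, and the
  action on facets of the generator of the cyclic group; the class of \<open>m\<close> acts by its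
  \<open>m\<close>-th power. Maps are extensional (undefined outside their domain), so that equality of
  maps is equality on the domain.\<close>

record ('a, 'f) piece_bundle =
  pieces :: "'a set"
  facets :: "'f set"
  proj :: "'f \<Rightarrow> 'a"
  gen :: "'f \<Rightarrow> 'f"

type_synonym ('a, 'f, 'b, 'g) bundle_map = "('a \<Rightarrow> 'b) \<times> ('f \<Rightarrow> 'g)"

definition bundle_iso ::
  "('a, 'f) piece_bundle \<Rightarrow> ('b, 'g) piece_bundle \<Rightarrow> ('a, 'f, 'b, 'g) bundle_map set" where
  "bundle_iso A B = {(f, F).
     f \<in> extensional (pieces A) \<and> bij_betw f (pieces A) (pieces B) \<and>
     F \<in> extensional (facets A) \<and> bij_betw F (facets A) (facets B) \<and>
     (\<forall>x\<in>facets A. proj B (F x) = f (proj A x)) \<and>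
     (\<forall>x\<in>facets A. \<forall>m. F ((gen A ^^ m) x) = (gen B ^^ m) (F x))}"

definition bundle_comp ::
  "('a, 'f) piece_bundle \<Rightarrow> ('b, 'g, 'c, 'h) bundle_map \<Rightarrow> ('a, 'f, 'b, 'g) bundle_map
     \<Rightarrow> ('a, 'f, 'c, 'h) bundle_map" where
  "bundle_comp A q p =
     (compose (pieces A) (fst q) (fst p), compose (facets A) (snd q) (snd p))"

definition bundle_inv ::
  "('a, 'f) piece_bundle \<Rightarrow> ('b, 'g) piece_bundle \<Rightarrow> ('a, 'f, 'b, 'g) bundle_map
     \<Rightarrow> ('b, 'g, 'a, 'f) bundle_map" where
  "bundle_inv A B p =
     (restrict (inv_into (pieces A) (fst p)) (pieces B),
      restrict (inv_into (facets A) (snd p)) (facets B))"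

definition bundle_aut :: "('a, 'f) piece_bundle \<Rightarrow> ('a, 'f, 'a, 'f) bundle_map monoid" where
  "bundle_aut A = \<lparr>carrier = bundle_iso A A, monoid.mult = bundle_comp A,
     one = (\<lambda>a\<in>pieces A. a, \<lambda>x\<in>facets A. x)\<rparr>"


section \<open>Geometric pieces\<close>

definition cubies :: "vec set" where
  "cubies = {c. (\<forall>i. coord i c \<in> {-3, -1, 1, 3}) \<and> (\<exists>i. coord i c \<in> {-3, 3})}"

definition cubies_with :: "nat \<Rightarrow> vec set" where
  "cubies_with k = {c \<in> cubies. card {i. coord i c \<in> {-3, 3}} = k}"

definition ArGeom :: "vec set" where "ArGeom = cubies_with 2"
definition SomGeom :: "vec set" where "SomGeom = cubies_with 3"
definition CentGeom :: "vec set" where "CentGeom = cubies_with 1"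

definition normals :: "vec set" where
  "normals = range basis \<union> range (\<lambda>i. - basis i)"

type_synonym gfacet = "vec \<times> vec"

definition geom_facets :: "vec set \<Rightarrow> gfacet set" where
  "geom_facets S = {(c, n). c \<in> S \<and> n \<in> normals \<and> dot c n = 3}"

definition edge_swap :: "gfacet \<Rightarrow> gfacet" where
  "edge_swap = (\<lambda>(c, n). (c, THE n'. (c, n') \<in> geom_facets ArGeom \<and> n' \<noteq> n))"

text \<open>Rodrigues' formula for the direct rotation of angle \<open>2\<pi>/3\<close> about the axis directed by
  \<open>w = - c/3\<close>: since \<open>w\<close> has norm \<open>\<surd>3\<close>, it reads \<open>v \<mapsto> (- v + w \<times> v + \<langle>w, v\<rangle> w) / 2\<close>.
  Both divisions are exact when \<open>c\<close> is a corner and \<open>v\<close> is integral.\<close>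

definition corner_turn :: "vec \<Rightarrow> vec \<Rightarrow> vec" where
  "corner_turn c v =
     (let w = vdiv (- c) 3 in vdiv (- v + cross w v + smul (dot w v) w) 2)"

definition edge_geom :: "(vec, gfacet) piece_bundle" where
  "edge_geom = \<lparr>pieces = ArGeom, facets = geom_facets ArGeom, proj = fst, gen = edge_swap\<rparr>"

definition corner_geom :: "(vec, gfacet) piece_bundle" where
  "corner_geom = \<lparr>pieces = SomGeom, facets = geom_facets SomGeom, proj = fst,
     gen = (\<lambda>(c, n). (c, corner_turn c n))\<rparr>"


section \<open>Material pieces\<close>

datatype colour = Bla | Jau | Ble | Ver | Ora | Rou

fun opposite :: "colour \<Rightarrow> colour" where
  "opposite Bla = Jau" | "opposite Jau = Bla"
| "opposite Ble = Ver" | "opposite Ver = Ble"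
| "opposite Ora = Rou" | "opposite Rou = Ora"

definition compatible :: "colour \<Rightarrow> colour \<Rightarrow> bool" where
  "compatible a b \<longleftrightarrow> a \<noteq> b \<and> b \<noteq> opposite a"

type_synonym medge = "colour set \<times> nat"
type_synonym mcorner = "colour set"

definition ArMat :: "medge set" where
  "ArMat = {{a, b} | a b. compatible a b} \<times> {1, 2}"

definition SomMat :: "mcorner set" where
  "SomMat = {{a, b, c} | a b c. compatible a b \<and> compatible b c \<and> compatible a c}"

definition CentMat :: "(colour \<times> nat) set" where
  "CentMat = UNIV \<times> {1, 2, 3, 4}"

definition edge_mat :: "(medge, medge \<times> colour) piece_bundle" where
  "edge_mat = \<lparr>pieces = ArMat, facets = {((P, j), c). (P, j) \<in> ArMat \<and> c \<in> P}, proj = fst,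
     gen = (\<lambda>((P, j), c). ((P, j), THE c'. c' \<in> P \<and> c' \<noteq> c))\<rparr>"

text \<open>The list \<open>[a, b, c]\<close> stands for the cycle \<open>a \<mapsto> b \<mapsto> c \<mapsto> a\<close>.\<close>

definition corner_cycles :: "colour list set" where
  "corner_cycles = {[Bla, Ble, Rou], [Bla, Ora, Ble], [Bla, Ver, Ora], [Bla, Rou, Ver],
                    [Jau, Rou, Ble], [Jau, Ble, Ora], [Jau, Ver, Rou], [Jau, Ora, Ver]}"

definition corner_mat :: "(mcorner, mcorner \<times> colour) piece_bundle" where
  "corner_mat = \<lparr>pieces = SomMat, facets = {(T, c). T \<in> SomMat \<and> c \<in> T}, proj = fst,
     gen = (\<lambda>(T, c). (T, cycle_of_list (THE cs. cs \<in> corner_cycles \<and> set cs = T) c))\<rparr>"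


section \<open>Marked colourings and transformations\<close>

text \<open>Triples of maps of edges, corners and centres, of which the triples of bundle isomorphisms
  between geometric and material pieces, or automorphisms of either, are instances.\<close>

type_synonym ('a, 'f, 'b, 'g, 'c, 'h, 'd, 'k, 'm, 'n) triple_map =
  "('a, 'f, 'b, 'g) bundle_map \<times> ('c, 'h, 'd, 'k) bundle_map \<times> ('m \<Rightarrow> 'n)"

type_synonym state =
  "(vec, gfacet, medge, medge \<times> colour, vec, gfacet, mcorner, mcorner \<times> colour,
    vec, colour \<times> nat) triple_map"

type_synonym geom_transf =
  "(vec, gfacet, vec, gfacet, vec, gfacet, vec, gfacet, vec, vec) triple_map"

type_synonym mat_transf =
  "(medge, medge \<times> colour, medge, medge \<times> colour,
    mcorner, mcorner \<times> colour, mcorner, mcorner \<times> colour,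
    colour \<times> nat, colour \<times> nat) triple_map"

definition Rev_marq :: "state set" where
  "Rev_marq = bundle_iso edge_geom edge_mat \<times> bundle_iso corner_geom corner_mat \<times>
     {h \<in> extensional CentGeom. bij_betw h CentGeom CentMat}"

definition T_geom :: "geom_transf monoid" where
  "T_geom = bundle_aut edge_geom \<times>\<times> (bundle_aut corner_geom \<times>\<times> BijGroup CentGeom)"

definition T_mat :: "mat_transf monoid" where
  "T_mat = bundle_aut edge_mat \<times>\<times> (bundle_aut corner_mat \<times>\<times> BijGroup CentMat)"

text \<open>Composition of triples of maps whose inner map is defined on the geometric (respectively
  material) pieces. On states, \<open>comp_geom u x\<close> is the left action of \<open>u\<close> in \<open>T_mat\<close> and
  \<open>comp_geom x t\<close> the right action of \<open>t\<close> in \<open>T_geom\<close>.\<close>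

definition comp_geom ::
  "('b, 'g, 'b', 'g', 'd, 'k, 'd', 'k', 'n, 'n') triple_map
     \<Rightarrow> (vec, gfacet, 'b, 'g, vec, gfacet, 'd, 'k, vec, 'n) triple_map
     \<Rightarrow> (vec, gfacet, 'b', 'g', vec, gfacet, 'd', 'k', vec, 'n') triple_map" where
  "comp_geom = (\<lambda>(a', b', h') (a, b, h).
     (bundle_comp edge_geom a' a, bundle_comp corner_geom b' b, compose CentGeom h' h))"

definition comp_mat ::
  "('b, 'g, 'b', 'g', 'd, 'k, 'd', 'k', 'n, 'n') triple_map
     \<Rightarrow> (medge, medge \<times> colour, 'b, 'g, mcorner, mcorner \<times> colour, 'd, 'k,
         colour \<times> nat, 'n) triple_map
     \<Rightarrow> (medge, medge \<times> colour, 'b', 'g', mcorner, mcorner \<times> colour, 'd', 'k',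
         colour \<times> nat, 'n') triple_map" where
  "comp_mat = (\<lambda>(a', b', h') (a, b, h).
     (bundle_comp edge_mat a' a, bundle_comp corner_mat b' b, compose CentMat h' h))"

definition state_inv ::
  "state \<Rightarrow> (medge, medge \<times> colour, vec, gfacet, mcorner, mcorner \<times> colour, vec, gfacet,
             colour \<times> nat, vec) triple_map" where
  "state_inv = (\<lambda>(a, b, h).
     (bundle_inv edge_geom edge_mat a, bundle_inv corner_geom corner_mat b,
      restrict (inv_into CentGeom h) CentMat))"


section \<open>Legal moves\<close>

definition slice_cubie :: "axis \<Rightarrow> int \<Rightarrow> vec \<Rightarrow> vec" where
  "slice_cubie i v c = (if coord i c = v then quarter_turn i c else c)"

definition slice_facet :: "axis \<Rightarrow> int \<Rightarrow> gfacet \<Rightarrow> gfacet" where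
  "slice_facet i v = (\<lambda>(c, n).
     if coord i c = v then (quarter_turn i c, quarter_turn i n) else (c, n))"

definition slice_move :: "axis \<Rightarrow> int \<Rightarrow> geom_transf" where
  "slice_move i v =
     ((restrict (slice_cubie i v) ArGeom, restrict (slice_facet i v) (geom_facets ArGeom)),
      (restrict (slice_cubie i v) SomGeom, restrict (slice_facet i v) (geom_facets SomGeom)),
      restrict (slice_cubie i v) CentGeom)"

definition legal :: "geom_transf set" where
  "legal = generate T_geom {slice_move i v | i v. v \<in> {-3, -1, 1, 3}}"


section \<open>Indistinguishable transformations and the solved state\<close>

definition I_ArMat :: "(medge, medge \<times> colour, medge, medge \<times> colour) bundle_map set" where
  "I_ArMat = {(f, F) \<in> carrier (bundle_aut edge_mat).
     \<forall>x\<in>facets edge_mat. snd (F x) = snd x \<and> fst (fst (F x)) = fst (fst x)}"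

definition I_CentMat :: "(colour \<times> nat \<Rightarrow> colour \<times> nat) set" where
  "I_CentMat = {h \<in> carrier (BijGroup CentMat). \<forall>x\<in>CentMat. fst (h x) = fst x}"

definition indist :: "mat_transf set" where
  "indist = I_ArMat \<times> {\<one>\<^bsub>bundle_aut corner_mat\<^esub>} \<times> I_CentMat"

definition col :: "vec \<Rightarrow> colour" where
  "col n =
     (if n = basis E1 then Rou else if n = - basis E1 then Ora
      else if n = basis E2 then Ble else if n = - basis E2 then Ver
      else if n = basis E3 then Bla else Jau)"

definition solved_state :: "state \<Rightarrow> bool" where
  "solved_state = (\<lambda>((f, F), (g, G), h).
     ((f, F), (g, G), h) \<in> Rev_marq \<and>
     (\<forall>(c, n) \<in> geom_facets ArGeom. snd (F (c, n)) = col n) \<and>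
     (\<forall>(c, n) \<in> geom_facets SomGeom. snd (G (c, n)) = col n) \<and>
     (\<forall>(c, n) \<in> geom_facets CentGeom. fst (h c) = col n))"


section \<open>Mechanical constraints\<close>

definition edge_section :: "vec \<Rightarrow> gfacet" where
  "edge_section c = (c, THE n. \<exists>n' k.
     (c, n) \<in> geom_facets ArGeom \<and> (c, n') \<in> geom_facets ArGeom \<and> n \<noteq> n' \<and>
     coord k c \<in> {-1, 1} \<and> det3 n n' (smul (coord k c) (basis k)) > 0)"

definition T_geom' :: "geom_transf set" where
  "T_geom' = {((\<sigma>, \<Phi>), (\<tau>, \<Psi>), \<phi>) \<in> carrier T_geom.
     \<forall>\<alpha>\<in>ArGeom. \<Phi> (edge_section \<alpha>) = edge_section (\<sigma> \<alpha>)}"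

definition Rev_meca :: "state \<Rightarrow> state set" where
  "Rev_meca x0 = {comp_geom x0 t | t. t \<in> T_geom'}"

definition indist' :: "state \<Rightarrow> mat_transf set" where
  "indist' x0 = indist \<inter> {comp_mat (comp_geom x0 t) (state_inv x0) | t. t \<in> T_geom'}"

definition double_orbit :: "state \<Rightarrow> state \<Rightarrow> state set" where
  "double_orbit x0 x = {comp_geom (comp_geom u x) l | u l. u \<in> indist' x0 \<and> l \<in> legal}"

definition Ineq_meca :: "state \<Rightarrow> state set set" where
  "Ineq_meca x0 = {double_orbit x0 x | x. x \<in> Rev_meca x0}"

end

theory Submission
  imports Defs
begin

text \<open>
  A transformation satisfying the mechanical constraint is determined by a permutation of the edges,
  a bundle automorphism of the corners and a permutation of the centres (\<open>T_geom'_eqI\<close>). The only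
  obstruction to passing from one state to another is the total twist of the corners: measure how
  an automorphism turns the facets of each corner against a reference facet, and add the results
  modulo 3. The choice of reference facets cancels in the sum, which turns products into sums
  (\<open>twist_comp\<close>); it vanishes on the slice moves, hence on legal moves (\<open>twist_legal\<close>), and on
  indistinguishable transformations, which do not touch the corners. So double orbits lie inside
  the classes of equal twist, of which there are three, all inhabited.

  Conversely each class is a single double orbit (\<open>double_coset\<close>). Given \<open>w\<close> and \<open>s\<close> of equal twist,
  the corner part of \<open>w\<^sup>-\<^sup>1 s\<close> has twist zero and is that of a legal move
  (\<open>legal_corner_part\<close>): legal moves realise all permutations of the corners, and turn any two
  corners in opposite directions. Dividing by it leaves a transformation that is trivial on the
  corners. Such a transformation is legal as soon as it is even on the centres
  (\<open>even_centres_legal\<close>), and the parity on the centres can be changed at will by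
  exchanging two centres of the same colour, which is an indistinguishable transformation
  (\<open>fix_centre_parity\<close>).

  All generation statements come from one principle (\<open>all_cyc3_from_seed\<close>, instantiated in
  \<open>slice_action\<close>): for edges, corners and centres alike, a single commutator acts as a
  three-cycle no slice contains entirely, and this, with transitivity, yields all
  three-cycles and hence all even permutations. The finitely many computations on cubies are
  carried out by evaluation.
\<close>

section \<open>Three-cycles and even permutations\<close>

definition cyc3 :: "'a \<Rightarrow> 'a \<Rightarrow> 'a \<Rightarrow> 'a \<Rightarrow> 'a" where
  "cyc3 a b c = transpose a b \<circ> transpose b c"

lemma cyc3_apply:
  assumes "distinct [a, b, c]"
  shows "cyc3 a b c x = (if x = a then b else if x = b then c else if x = c then a else x)"
  using assms by (auto simp: cyc3_def transpose_def)

lemma cyc3_rotate: "distinct [a, b, c] \<Longrightarrow> cyc3 b c a = cyc3 a b c"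
  by (rule ext) (auto simp: cyc3_apply)

lemma cyc3_cancel: "distinct [a, b, c] \<Longrightarrow> cyc3 a c b \<circ> cyc3 a b c = id"
  by (rule ext) (auto simp: cyc3_apply)

lemma cyc3_conj:
  fixes q q' :: "'a \<Rightarrow> 'a"
  assumes "distinct [a, b, c]" "q \<circ> q' = id" "q' \<circ> q = id"
  shows "q \<circ> cyc3 a b c \<circ> q' = cyc3 (q a) (q b) (q c)"
proof -
  have 1: "q (q' x) = x" "q' (q x) = x" for x
    using assms(2,3) by (auto simp: fun_eq_iff)
  have 2: "q' x = u \<longleftrightarrow> x = q u" for x u
    using 1 by metis
  have "distinct [q a, q b, q c]"
    using assms(1) by (simp add: 2[symmetric] 1)
  with assms(1) show ?thesis
    by (intro ext) (simp add: cyc3_apply 1 2)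
qed

text \<open>If the transpositions share a point, their product is a three-cycle or the identity;
  otherwise insert \<open>(b c)(b c)\<close> between them.\<close>

lemma two_transpositions:
  assumes comp: "\<And>p q. p \<in> H \<Longrightarrow> q \<in> H \<Longrightarrow> p \<circ> q \<in> H" and "id \<in> H"
    and cyc: "\<And>a b c. a \<in> S \<Longrightarrow> b \<in> S \<Longrightarrow> c \<in> S \<Longrightarrow> distinct [a, b, c] \<Longrightarrow> cyc3 a b c \<in> H"
    and S: "a \<in> S" "b \<in> S" "c \<in> S" "d \<in> S" and ab: "a \<noteq> b" and cd: "c \<noteq> d"
  shows "transpose a b \<circ> transpose c d \<in> H"
proof -
  have share: "transpose x y \<circ> transpose y z \<in> H"
    if "x \<in> S" "y \<in> S" "z \<in> S" "x \<noteq> y" "y \<noteq> z" for x y z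
  proof (cases "x = z")
    case True
    then have "transpose x y \<circ> transpose y z = id" by (simp add: transpose_commute[of y] id_def fun_eq_iff)
    with \<open>id \<in> H\<close> show ?thesis by (simp only:)
  next
    case False
    then show ?thesis using cyc[of x y z] that by (simp add: cyc3_def)
  qed
  show ?thesis
  proof (cases "b = c")
    case True
    then show ?thesis using share[of a b d] S ab cd by simp
  next
    case False
    have "transpose a b \<circ> transpose c d
      = (transpose a b \<circ> transpose b c) \<circ> (transpose b c \<circ> transpose c d)"
      by (simp add: fun_eq_iff)
    moreover have "transpose a b \<circ> transpose b c \<in> H" "transpose b c \<circ> transpose c d \<in> H"
      using share S ab cd False by auto
    ultimately show ?thesis by (metis comp)
  qed
qed

text \<open>The induction over transpositions has to carry a statement for odd permutations too: these become
  members after one more transposition, whichever it is.\<close>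

lemma evenperm_in_three_cycle_closure:
  assumes comp: "\<And>p q. p \<in> H \<Longrightarrow> q \<in> H \<Longrightarrow> p \<circ> q \<in> H" and id: "id \<in> H"
    and cyc: "\<And>a b c. a \<in> S \<Longrightarrow> b \<in> S \<Longrightarrow> c \<in> S \<Longrightarrow> distinct [a, b, c] \<Longrightarrow> cyc3 a b c \<in> H"
    and "finite S" "p permutes S" "evenperm p"
  shows "p \<in> H"
proof -
  have "(evenperm p \<longrightarrow> p \<in> H) \<and>
    (\<not> evenperm p \<longrightarrow> (\<forall>c\<in>S. \<forall>d\<in>S. c \<noteq> d \<longrightarrow> transpose c d \<circ> p \<in> H))"
    using \<open>p permutes S\<close> \<open>finite S\<close>
  proof (induction rule: permutes_induct)
    case id
    then show ?case using assms(2) by (auto simp: id_def)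
  next
    case (swap a b p)
    have even: "evenperm (transpose a b \<circ> p) \<longleftrightarrow> \<not> evenperm p"
      using swap \<open>finite S\<close> permutation_permutes
      by (metis evenperm_comp evenperm_swap permutation_swap_id)
    have "transpose c d \<circ> (transpose a b \<circ> p) \<in> H"
      if "c \<in> S" "d \<in> S" "c \<noteq> d" "evenperm p" for c d
    proof -
      have "transpose c d \<circ> transpose a b \<in> H"
        by (rule two_transpositions[where S = S]) (use comp id cyc that swap in auto)
      moreover have "p \<in> H" using swap that by simp
      ultimately show ?thesis using comp by (metis comp_assoc)
    qed
    then show ?case using swap.IH swap.hyps even by blast
  qed
  with \<open>evenperm p\<close> show ?thesis by simp
qed

text \<open>Two points are linked when some three-cycle of \<open>H\<close> moves both. Up to inversion it does not
  matter in which order the three-cycle visits them.\<close>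

definition cyc3_linked :: "('a \<Rightarrow> 'a) set \<Rightarrow> 'a \<Rightarrow> 'a \<Rightarrow> bool" where
  "cyc3_linked H a b \<longleftrightarrow> a = b \<or> (\<exists>c. distinct [a, b, c] \<and> cyc3 a b c \<in> H)"

locale cyc3_closed =
  fixes H :: "('a \<Rightarrow> 'a) set"
  assumes comp: "p \<in> H \<Longrightarrow> q \<in> H \<Longrightarrow> p \<circ> q \<in> H"
begin

lemma cyc3_inverse:
  assumes "cyc3 a b c \<in> H" "distinct [a, b, c]"
  shows "cyc3 a c b \<in> H"
proof -
  have "cyc3 a c b = cyc3 a b c \<circ> cyc3 a b c"
    using assms(2) by (intro ext) (auto simp: cyc3_apply)
  with assms(1) comp show ?thesis by simp
qed

lemma cyc3_conj_mem:
  assumes "cyc3 a b c \<in> H" "distinct [a, b, c]" "cyc3 u v w \<in> H" "distinct [u, v, w]"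
  shows "cyc3 (cyc3 u v w a) (cyc3 u v w b) (cyc3 u v w c) \<in> H"
proof -
  have "cyc3 u w v \<in> H" using cyc3_inverse assms by blast
  moreover have "cyc3 u v w \<circ> cyc3 u w v = id" "cyc3 u w v \<circ> cyc3 u v w = id"
    using cyc3_cancel[of u v w] cyc3_cancel[of u w v] assms(4) by auto
  ultimately show ?thesis
    using cyc3_conj[OF assms(2)] assms comp by metis
qed

lemma linked_sym:
  assumes "cyc3_linked H a b" shows "cyc3_linked H b a"
proof -
  have "cyc3 b a c \<in> H" if "distinct [a, b, c]" "cyc3 a b c \<in> H" for c
    using cyc3_inverse[OF that(2,1)] cyc3_rotate[of b a c] that(1) by auto
  then show ?thesis using assms by (fastforce simp: cyc3_linked_def)
qed

lemma linkedI: "cyc3 a b c \<in> H \<Longrightarrow> distinct [a, b, c] \<Longrightarrow> cyc3_linked H a b"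
  by (auto simp: cyc3_linked_def)

text \<open>Conjugating one of the two given three-cycles by the other produces one through \<open>a\<close> and \<open>d\<close>; the
  case distinction is on which points the two cycles share besides \<open>b\<close>.\<close>

lemma linked_trans:
  assumes "cyc3_linked H a b" "cyc3_linked H b d"
  shows "cyc3_linked H a d"
proof (cases "a = b \<or> b = d \<or> a = d")
  case True
  then show ?thesis using assms by (auto simp: cyc3_linked_def)
next
  case False
  with assms obtain c e where c: "distinct [a, b, c]" "cyc3 a b c \<in> H"
    and e: "distinct [b, d, e]" "cyc3 b d e \<in> H"
    by (auto simp: cyc3_linked_def)
  have c': "cyc3 a c b \<in> H" "distinct [a, c, b]" using cyc3_inverse[OF c(2,1)] c(1) by auto
  consider "d = c" | "e = a" | "d \<noteq> c" "e \<noteq> a" by blast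
  then show ?thesis
  proof cases
    case 1
    then show ?thesis using c' linkedI by blast
  next
    case 2
    then have "cyc3 a b d \<in> H" using e cyc3_rotate[of a b d] False by auto
    then have "cyc3 a d b \<in> H" using cyc3_inverse False by auto
    then show ?thesis using linkedI[of a d b] False by auto
  next
    case 3
    have "cyc3 (cyc3 a c b b) (cyc3 a c b d) (cyc3 a c b e) \<in> H"
      using cyc3_conj_mem[OF e(2,1) c'] .
    moreover have "cyc3 a c b b = a" "cyc3 a c b d = d"
      using c'(2) False 3 by (auto simp: cyc3_apply)
    moreover have "cyc3 a c b e = (if e = c then b else e)"
      using c'(2) e(1) 3 by (auto simp: cyc3_apply)
    ultimately have "cyc3 a d (if e = c then b else e) \<in> H" by simp
    then show ?thesis using linkedI[of a d] False 3 e(1) by auto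
  qed
qed

text \<open>Starting from a three-cycle \<open>(a b c)\<close> in \<open>H\<close>, the third point is moved from \<open>c\<close> to \<open>d\<close> by conjugation
  with a three-cycle through \<open>c\<close> and \<open>d\<close>. If that one meets \<open>a\<close> or \<open>b\<close>, conjugating it
  by \<open>(a b c)\<close> in turn gives what is wanted.\<close>

lemma linked_imp_cyc3:
  assumes linked: "\<And>u v. u \<in> S \<Longrightarrow> v \<in> S \<Longrightarrow> cyc3_linked H u v"
    and supp: "\<And>u v w. distinct [u, v, w] \<Longrightarrow> cyc3 u v w \<in> H \<Longrightarrow> {u, v, w} \<subseteq> S"
    and S: "a \<in> S" "b \<in> S" "d \<in> S" and dist: "distinct [a, b, d]"
  shows "cyc3 a b d \<in> H"
proof -
  obtain c where c: "distinct [a, b, c]" "cyc3 a b c \<in> H"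
    using linked[OF S(1,2)] dist by (auto simp: cyc3_linked_def)
  show ?thesis
  proof (cases "d = c")
    case True
    then show ?thesis using c by simp
  next
    case False
    have "c \<in> S" using supp[OF c] by simp
    then obtain f where f: "distinct [c, d, f]" "cyc3 c d f \<in> H"
      using linked[of c d] S False by (auto simp: cyc3_linked_def)
    have conj_c: "cyc3 (cyc3 c d f a) (cyc3 c d f b) (cyc3 c d f c) \<in> H"
      using cyc3_conj_mem[OF c(2,1) f(2,1)] .
    consider "f \<noteq> a" "f \<noteq> b" | "f = a" | "f = b" by blast
    then show ?thesis
    proof cases
      case 1
      then show ?thesis using conj_c f(1) c(1) dist by (auto simp: cyc3_apply)
    next
      case 2
      \<comment> \<open>Conjugating \<open>(c d a)\<close> by \<open>(a b c)\<close> gives \<open>(a d b)\<close>.\<close>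
      have "cyc3 (cyc3 a b c c) (cyc3 a b c d) (cyc3 a b c f) \<in> H"
        using cyc3_conj_mem[OF f(2,1) c(2,1)] .
      then have "cyc3 a d b \<in> H" using 2 False c(1) dist by (auto simp: cyc3_apply)
      then show ?thesis using cyc3_inverse[of a d b] dist by auto
    next
      case 3
      have c': "cyc3 a c b \<in> H" "distinct [a, c, b]" using cyc3_inverse[OF c(2,1)] c(1) by auto
      have "cyc3 (cyc3 a c b c) (cyc3 a c b d) (cyc3 a c b f) \<in> H"
        using cyc3_conj_mem[OF f(2,1) c'] .
      then have "cyc3 b d a \<in> H" using 3 False c(1) dist by (auto simp: cyc3_apply)
      then show ?thesis using cyc3_rotate[of a b d] dist by auto
    qed
  qed
qed

text \<open>Being linked is an equivalence relation preserved by \<open>G\<close>, so the points linked to \<open>x\<close> form a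
  block: an element of \<open>G\<close> that fixes one point of the block maps the block to itself. When every
  generator fixes a point of the seed, the block is stable under all of \<open>G\<close>, and transitivity
  makes it everything.\<close>

lemma all_cyc3_from_seed:
  assumes seed: "cyc3 x y z \<in> H" "distinct [x, y, z]"
    and supp: "\<And>u v w. distinct [u, v, w] \<Longrightarrow> cyc3 u v w \<in> H \<Longrightarrow> {u, v, w} \<subseteq> S"
    and symm: "\<And>g u v w. g \<in> G \<Longrightarrow> distinct [u, v, w] \<Longrightarrow> cyc3 u v w \<in> H
      \<Longrightarrow> cyc3 (g u) (g v) (g w) \<in> H \<and> distinct [g u, g v, g w]"
    and fixed: "\<And>g. g \<in> G \<Longrightarrow> g x = x \<or> g y = y \<or> g z = z"
    and trans: "\<And>B. x \<in> B \<Longrightarrow> (\<And>g u. g \<in> G \<Longrightarrow> u \<in> B \<Longrightarrow> g u \<in> B) \<Longrightarrow> S \<subseteq> B"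
    and S: "a \<in> S" "b \<in> S" "c \<in> S" "distinct [a, b, c]"
  shows "cyc3 a b c \<in> H"
proof -
  let ?B = "{u. cyc3_linked H x u}"
  have xyz: "cyc3_linked H x x" "cyc3_linked H x y" "cyc3_linked H x z"
    using seed linkedI cyc3_inverse[OF seed] by (auto simp: cyc3_linked_def)
  have image: "cyc3_linked H (g u) (g v)" if "g \<in> G" "cyc3_linked H u v" for g u v
  proof (cases "u = v")
    case False
    then obtain w where "distinct [u, v, w]" "cyc3 u v w \<in> H"
      using \<open>cyc3_linked H u v\<close> by (auto simp: cyc3_linked_def)
    then show ?thesis using symm[OF \<open>g \<in> G\<close>] linkedI by blast
  qed (simp add: cyc3_linked_def)
  have "g u \<in> ?B" if "g \<in> G" "u \<in> ?B" for g u
  proof -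
    obtain p where p: "cyc3_linked H x p" "g p = p" using fixed[OF \<open>g \<in> G\<close>] xyz by blast
    have "cyc3_linked H (g p) (g u)"
      using image[OF \<open>g \<in> G\<close>, of p u] p(1) that(2) linked_sym[of x p] linked_trans[of p x u] by simp
    then show ?thesis using p linked_trans[of x "g p" "g u"] by simp
  qed
  then have "S \<subseteq> ?B" using trans[of ?B] xyz(1) by blast
  then have "cyc3_linked H u v" if "u \<in> S" "v \<in> S" for u v
    using that linked_sym[of x u] linked_trans[of u x v] by blast
  then show ?thesis using linked_imp_cyc3[of S a b c] supp S by blast
qed

end

section \<open>Bundle automorphisms\<close>

text \<open>Bundles are plain records, so that the generator preserves the facets, and that facets project
  to pieces, has to be required; without it extensional maps would not compose equivariantly.\<close>

definition bundle_closed :: "('a, 'f) piece_bundle \<Rightarrow> bool" where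
  "bundle_closed A \<longleftrightarrow> (\<forall>x\<in>facets A. proj A x \<in> pieces A \<and> gen A x \<in> facets A)"

lemma bundle_closed_funpow: "bundle_closed A \<Longrightarrow> x \<in> facets A \<Longrightarrow> (gen A ^^ m) x \<in> facets A"
  by (induction m) (auto simp: bundle_closed_def)

lemma bundle_isoI:
  assumes "bundle_closed A" "f \<in> extensional (pieces A)" "bij_betw f (pieces A) (pieces B)"
    and "F \<in> extensional (facets A)" "bij_betw F (facets A) (facets B)"
    and "\<And>x. x \<in> facets A \<Longrightarrow> proj B (F x) = f (proj A x)"
    and equiv: "\<And>x. x \<in> facets A \<Longrightarrow> F (gen A x) = gen B (F x)"
  shows "(f, F) \<in> bundle_iso A B"
proof -
  have "F ((gen A ^^ m) x) = (gen B ^^ m) (F x)" if "x \<in> facets A" for m x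
    using that by (induction m) (simp_all add: equiv bundle_closed_funpow[OF assms(1)])
  then show ?thesis using assms by (simp add: bundle_iso_def)
qed

lemma bundle_isoD:
  assumes "(f, F) \<in> bundle_iso A B"
  shows "f \<in> extensional (pieces A)" "bij_betw f (pieces A) (pieces B)"
    "F \<in> extensional (facets A)" "bij_betw F (facets A) (facets B)"
    "x \<in> facets A \<Longrightarrow> proj B (F x) = f (proj A x)"
    "x \<in> facets A \<Longrightarrow> F ((gen A ^^ m) x) = (gen B ^^ m) (F x)"
    "x \<in> facets A \<Longrightarrow> F (gen A x) = gen B (F x)"
    "c \<in> pieces A \<Longrightarrow> f c \<in> pieces B" "x \<in> facets A \<Longrightarrow> F x \<in> facets B"
proof -
  show "F (gen A x) = gen B (F x)" if "x \<in> facets A"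
  proof -
    have "F ((gen A ^^ 1) x) = (gen B ^^ 1) (F x)"
      using assms that unfolding bundle_iso_def by blast
    then show ?thesis by simp
  qed
qed (use assms in \<open>auto simp: bundle_iso_def dest: bij_betwE\<close>)

lemma bundle_comp_iso:
  assumes "bundle_closed A" "q \<in> bundle_iso B C" "p \<in> bundle_iso A B"
  shows "bundle_comp A q p \<in> bundle_iso A C"
proof -
  obtain f F g G where pq: "p = (f, F)" "q = (g, G)" by fastforce
  note p = assms(3)[unfolded pq, THEN bundle_isoD(2)] assms(3)[unfolded pq, THEN bundle_isoD(4)]
    assms(3)[unfolded pq, THEN bundle_isoD(5)] assms(3)[unfolded pq, THEN bundle_isoD(7)]
    assms(3)[unfolded pq, THEN bundle_isoD(9)]
  note q = assms(2)[unfolded pq, THEN bundle_isoD(2)] assms(2)[unfolded pq, THEN bundle_isoD(4)]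
    assms(2)[unfolded pq, THEN bundle_isoD(5)] assms(2)[unfolded pq, THEN bundle_isoD(7)]
  have "(compose (pieces A) g f, compose (facets A) G F) \<in> bundle_iso A C"
    using assms(1) p q
    by (intro bundle_isoI) (auto simp: bij_betw_compose compose_eq bundle_closed_def)
  then show ?thesis by (simp add: bundle_comp_def pq)
qed

lemma bundle_inv_iso:
  assumes A: "bundle_closed A" and B: "bundle_closed B" and p: "p \<in> bundle_iso A B"
  shows "bundle_inv A B p \<in> bundle_iso B A"
proof -
  obtain f F where pf: "p = (f, F)" by fastforce
  note iso = bundle_isoD[OF p[unfolded pf]]
  let ?f = "restrict (inv_into (pieces A) f) (pieces B)"
  let ?F = "restrict (inv_into (facets A) F) (facets B)"
  have F: "inv_into (facets A) F (F x) = x" if "x \<in> facets A" for x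
    using that iso(4) by (simp add: bij_betw_inv_into_left)
  have f: "inv_into (pieces A) f (f c) = c" if "c \<in> pieces A" for c
    using that iso(2) by (simp add: bij_betw_inv_into_left)
  have surj: "\<exists>x\<in>facets A. y = F x" if "y \<in> facets B" for y
    using that iso(4) by (auto simp: bij_betw_def)
  have "(?f, ?F) \<in> bundle_iso B A"
  proof (rule bundle_isoI[OF B])
    fix y assume "y \<in> facets B"
    then obtain x where x: "x \<in> facets A" "y = F x" using surj by blast
    then have pr: "proj A x \<in> pieces A" "gen A x \<in> facets A" using A by (auto simp: bundle_closed_def)
    show "proj A (?F y) = ?f (proj B y)"
      using x pr iso(5,8,9) F f by simp
    have "gen B y = F (gen A x)" using x iso(7) by simp
    then show "?F (gen B y) = gen A (?F y)"
      using x pr iso(9) F by simp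
  qed (use iso bij_betw_inv_into in \<open>auto\<close>)
  then show ?thesis by (simp add: bundle_inv_def pf)
qed

lemma bundle_one_iso:
  assumes "bundle_closed A"
  shows "(\<lambda>a\<in>pieces A. a, \<lambda>x\<in>facets A. x) \<in> bundle_iso A A"
  using assms by (intro bundle_isoI) (auto simp: bundle_closed_def bij_betw_def inj_on_def)

lemma bundle_comp_inv:
  assumes p: "p \<in> bundle_iso A B"
  shows "bundle_comp A (bundle_inv A B p) p = (\<lambda>a\<in>pieces A. a, \<lambda>x\<in>facets A. x)"
    and "bundle_comp B p (bundle_inv A B p) = (\<lambda>a\<in>pieces B. a, \<lambda>x\<in>facets B. x)"
  using p
  by (auto simp: bundle_comp_def bundle_inv_def bundle_iso_def compose_inv_into_id
      compose_id_inv_into bij_betw_imp_surj_on)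

lemma bundle_comp_assoc:
  assumes "p \<in> bundle_iso A B"
  shows "bundle_comp A r (bundle_comp A q p) = bundle_comp A (bundle_comp B r q) p"
  using assms
  by (auto simp: bundle_comp_def bundle_iso_def intro!: compose_assoc dest: bij_betwE)

lemma bundle_comp_one:
  assumes "p \<in> bundle_iso A B"
  shows "bundle_comp A (\<lambda>a\<in>pieces B. a, \<lambda>x\<in>facets B. x) p = p"
    and "bundle_comp A p (\<lambda>a\<in>pieces A. a, \<lambda>x\<in>facets A. x) = p"
  using assms
  by (auto simp: bundle_comp_def bundle_iso_def dest: bij_betwE intro!: Id_compose compose_Id)

theorem group_bundle_aut:
  assumes "bundle_closed A"
  shows "group (bundle_aut A)"
proof (rule groupI; unfold bundle_aut_def; simp)
  show "bundle_comp A p q \<in> bundle_iso A A"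
    if "p \<in> bundle_iso A A" "q \<in> bundle_iso A A" for p q
    using bundle_comp_iso assms that by blast
  show "(restrict (\<lambda>a. a) (pieces A), restrict (\<lambda>x. x) (facets A)) \<in> bundle_iso A A"
    using bundle_one_iso assms by blast
  show "bundle_comp A (bundle_comp A p q) r = bundle_comp A p (bundle_comp A q r)"
    if "p \<in> bundle_iso A A" "q \<in> bundle_iso A A" "r \<in> bundle_iso A A" for p q r
    using bundle_comp_assoc that by metis
  show "bundle_comp A (restrict (\<lambda>a. a) (pieces A), restrict (\<lambda>x. x) (facets A)) p = p"
    if "p \<in> bundle_iso A A" for p
    using bundle_comp_one that by blast
  show "\<exists>q\<in>bundle_iso A A. bundle_comp A q p =
      (restrict (\<lambda>a. a) (pieces A), restrict (\<lambda>x. x) (facets A))"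
    if "p \<in> bundle_iso A A" for p
    using bundle_inv_iso bundle_comp_inv assms that by blast
qed

section \<open>Enumerating the cube\<close>

text \<open>Lists of pieces and facets, and executable forms of the operations defined by a description
  operator, so that statements about the whole cube can be decided by evaluation.\<close>

definition axis_list :: "axis list" where
  "axis_list = [E1, E2, E3]"

lemma set_axis_list: "set axis_list = UNIV"
  using axis.exhaust by (auto simp: axis_list_def)

definition coord_list :: "int list" where
  "coord_list = [-3, -1, 1, 3]"

definition extreme :: "vec \<Rightarrow> nat" where
  "extreme c = length (filter (\<lambda>i. coord i c = 3 \<or> coord i c = - 3) axis_list)"

definition cubie_list :: "nat \<Rightarrow> vec list" where
  "cubie_list k = filter (\<lambda>c. extreme c = k)
     (List.product coord_list (List.product coord_list coord_list))"

definition normal_list :: "vec list" where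
  "normal_list = [(1, 0, 0), (-1, 0, 0), (0, 1, 0), (0, -1, 0), (0, 0, 1), (0, 0, -1)]"

lemma extreme_card: "card {i. coord i c \<in> {-3, 3}} = extreme c"
proof -
  have "{i. coord i c \<in> {-3, 3}} = set (filter (\<lambda>i. coord i c = 3 \<or> coord i c = - 3) axis_list)"
    using set_axis_list by auto
  moreover have "distinct (filter (\<lambda>i. coord i c = 3 \<or> coord i c = - 3) axis_list)"
    by (simp add: axis_list_def)
  ultimately show ?thesis by (simp only: extreme_def distinct_card)
qed

lemma set_cubie_list: "k > 0 \<Longrightarrow> cubies_with k = set (cubie_list k)"
proof -
  assume k: "k > 0"
  have "\<exists>i. coord i c \<in> {-3, 3}" if "extreme c = k" for c
  proof -
    have "{i. coord i c \<in> {-3, 3}} \<noteq> {}"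
      using that k extreme_card[of c] by (metis card.empty less_numeral_extra(3))
    then show ?thesis by blast
  qed
  moreover have "(\<forall>i. coord i c \<in> {-3, -1, 1, 3}) \<longleftrightarrow>
    c \<in> set (List.product coord_list (List.product coord_list coord_list))" for c
  proof -
    have all: "(\<forall>i. P i) \<longleftrightarrow> P E1 \<and> P E2 \<and> P E3" for P
      by (metis axis.exhaust)
    have "{-3, -1, 1, 3} = set coord_list" by (simp add: coord_list_def)
    then show ?thesis by (cases c) (simp only: all, simp)
  qed
  ultimately show ?thesis
    unfolding cubies_with_def cubies_def cubie_list_def extreme_card by auto
qed

lemma set_normal_list: "normals = set normal_list"
proof -
  have "range f = f ` set axis_list" for f :: "axis \<Rightarrow> vec" by (simp add: set_axis_list)
  then show ?thesis by (auto simp: normals_def normal_list_def axis_list_def uminus_prod_def)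
qed

definition facet_list :: "vec list \<Rightarrow> gfacet list" where
  "facet_list cs = filter (\<lambda>(c, n). dot c n = 3) (List.product cs normal_list)"

lemma set_facet_list: "geom_facets (set cs) = set (facet_list cs)"
  by (auto simp: geom_facets_def facet_list_def set_normal_list)

definition edges where "edges = cubie_list 2"
definition corners where "corners = cubie_list 3"
definition centres where "centres = cubie_list 1"
definition edge_facets where "edge_facets = facet_list edges"
definition corner_facets where "corner_facets = facet_list corners"

lemma ArGeom_list: "ArGeom = set edges"
  and SomGeom_list: "SomGeom = set corners"
  and CentGeom_list: "CentGeom = set centres"
  and ArFacets_list: "geom_facets ArGeom = set edge_facets"
  and SomFacets_list: "geom_facets SomGeom = set corner_facets"
  by (simp_all add: ArGeom_def SomGeom_def CentGeom_def set_cubie_list edges_def corners_def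
      centres_def edge_facets_def corner_facets_def set_facet_list)

definition slices :: "(axis \<times> int) list" where
  "slices = List.product axis_list coord_list"

text \<open>Turns a definite description over a finite candidate list into a filter that can be evaluated.\<close>

lemma the_filter:
  assumes "filter P xs = [a]" "\<And>x. Q x \<longleftrightarrow> x \<in> set xs \<and> P x"
  shows "(THE x. Q x) = a"
proof -
  have "Q x \<longleftrightarrow> x \<in> set (filter P xs)" for x using assms(2) by auto
  then show ?thesis using assms(1) by simp
qed

definition other_normals :: "vec \<Rightarrow> vec \<Rightarrow> vec list" where
  "other_normals c n = filter (\<lambda>n'. dot c n' = 3 \<and> n' \<noteq> n) normal_list"

definition swap_exec :: "gfacet \<Rightarrow> gfacet" where
  "swap_exec = (\<lambda>(c, n). (c, hd (other_normals c n)))"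

lemma edge_swap_exec:
  assumes "x \<in> geom_facets ArGeom"
  shows "edge_swap x = swap_exec x"
proof -
  have "list_all (\<lambda>(c, n). length (other_normals c n) = 1) edge_facets" by code_simp
  then obtain c n a where x: "x = (c, n)" "other_normals c n = [a]"
    using assms by (cases x) (auto simp: ArFacets_list list_all_iff length_Suc_conv)
  have "c \<in> ArGeom" using assms x by (simp add: geom_facets_def)
  then have "(THE n'. (c, n') \<in> geom_facets ArGeom \<and> n' \<noteq> n) = a"
    by (intro the_filter[OF x(2)[unfolded other_normals_def]])
      (auto simp: geom_facets_def set_normal_list)
  then show ?thesis using x by (simp add: edge_swap_def swap_exec_def)
qed

definition section_normals :: "vec \<Rightarrow> vec list" where
  "section_normals c = filter (\<lambda>n. dot c n = 3 \<and> list_ex (\<lambda>n'. dot c n' = 3 \<and> n \<noteq> n' \<and>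
     list_ex (\<lambda>k. (coord k c = 1 \<or> coord k c = - 1) \<and> det3 n n' (smul (coord k c) (basis k)) > 0) axis_list)
     normal_list) normal_list"

definition section_exec :: "vec \<Rightarrow> gfacet" where
  "section_exec c = (c, hd (section_normals c))"

lemma edge_section_exec:
  assumes "c \<in> ArGeom"
  shows "edge_section c = section_exec c"
proof -
  have "list_all (\<lambda>c. length (section_normals c) = 1) edges" by code_simp
  then obtain a where a: "section_normals c = [a]"
    using assms by (auto simp: ArGeom_list list_all_iff length_Suc_conv)
  have "(THE n. \<exists>n' k. (c, n) \<in> geom_facets ArGeom \<and> (c, n') \<in> geom_facets ArGeom \<and> n \<noteq> n' \<and>
     coord k c \<in> {-1, 1} \<and> det3 n n' (smul (coord k c) (basis k)) > 0) = a"
    using assms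
    by (intro the_filter[OF a[unfolded section_normals_def]])
      (auto simp: geom_facets_def set_normal_list list_ex_iff set_axis_list)
  then show ?thesis using a by (simp add: edge_section_def section_exec_def)
qed

lemma edge_geom_simps [simp]:
  "pieces edge_geom = ArGeom" "facets edge_geom = geom_facets ArGeom" "proj edge_geom = fst"
  "gen edge_geom = edge_swap"
  by (simp_all add: edge_geom_def)

lemma corner_geom_simps [simp]:
  "pieces corner_geom = SomGeom" "facets corner_geom = geom_facets SomGeom" "proj corner_geom = fst"
  "gen corner_geom = (\<lambda>(c, n). (c, corner_turn c n))"
  by (simp_all add: corner_geom_def)

abbreviation turn_facet :: "gfacet \<Rightarrow> gfacet" where
  "turn_facet \<equiv> \<lambda>(c, n). (c, corner_turn c n)"

lemma geom_facets_iff: "(c, n) \<in> geom_facets S \<longleftrightarrow> c \<in> S \<and> n \<in> set normal_list \<and> dot c n = 3"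
  by (simp add: geom_facets_def set_normal_list)

lemma bundle_closed_edge_geom: "bundle_closed edge_geom"
proof -
  have "list_all (\<lambda>(c, n). hd (other_normals c n) \<in> set normal_list \<and> dot c (hd (other_normals c n)) = 3) edge_facets"
    by code_simp
  note ball = this[unfolded list_all_iff ArFacets_list[symmetric]]
  have "c \<in> ArGeom \<and> swap_exec (c, n) \<in> geom_facets ArGeom" if "(c, n) \<in> geom_facets ArGeom" for c n
    using bspec[OF ball that] that by (auto simp: geom_facets_iff swap_exec_def simp del: dot.simps)
  then have "fst x \<in> ArGeom \<and> swap_exec x \<in> geom_facets ArGeom" if "x \<in> geom_facets ArGeom" for x
    using that by (metis prod.collapse)
  then show ?thesis
    by (simp add: bundle_closed_def edge_swap_exec)
qed

lemma bundle_closed_corner_geom: "bundle_closed corner_geom"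
proof -
  have "list_all (\<lambda>(c, n). corner_turn c n \<in> set normal_list \<and> dot c (corner_turn c n) = 3) corner_facets"
    by code_simp
  note ball = this[unfolded list_all_iff SomFacets_list[symmetric]]
  have turn: "c \<in> SomGeom \<and> turn_facet (c, n) \<in> geom_facets SomGeom" if "(c, n) \<in> geom_facets SomGeom" for c n
    using bspec[OF ball that] that by (auto simp: geom_facets_iff simp del: dot.simps)
  then have "fst x \<in> SomGeom \<and> turn_facet x \<in> geom_facets SomGeom" if "x \<in> geom_facets SomGeom" for x
    using that turn[of "fst x" "snd x"] by (simp add: split_beta)
  then show ?thesis
    by (simp add: bundle_closed_def)
qed

lemma turn_facet_cube:
  assumes "x \<in> geom_facets SomGeom" shows "turn_facet (turn_facet (turn_facet x)) = x"
proof -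
  have "list_all (\<lambda>x. turn_facet (turn_facet (turn_facet x)) = x) corner_facets" by code_simp
  then show ?thesis using assms by (simp add: SomFacets_list list_all_iff)
qed

text \<open>Membership in \<open>cubies_with k\<close> by inspection of the coordinates, since searching
  \<open>cubie_list k\<close> would enumerate the cube anew for every query.\<close>

definition is_cubie :: "nat \<Rightarrow> vec \<Rightarrow> bool" where
  "is_cubie k = (\<lambda>(x, y, z). extreme (x, y, z) = k \<and> x \<in> set coord_list \<and> y \<in> set coord_list \<and> z \<in> set coord_list)"

lemma is_cubie: "k > 0 \<Longrightarrow> c \<in> cubies_with k \<longleftrightarrow> is_cubie k c"
  by (cases c) (auto simp: set_cubie_list cubie_list_def is_cubie_def)

lemma slice_cubies:
  "list_all (\<lambda>k. list_all (\<lambda>c. list_all (\<lambda>(i, v). is_cubie k (slice_cubie i v c)) slices) (cubie_list k)) [1, 2, 3]"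
  by code_simp

lemma slice_section:
  "list_all (\<lambda>c. list_all (\<lambda>(i, v). slice_facet i v (section_exec c) = section_exec (slice_cubie i v c)) slices) edges"
  by code_simp

lemma slice_swap:
  "list_all (\<lambda>x. list_all (\<lambda>(i, v).
       slice_facet i v (swap_exec x) = swap_exec (slice_facet i v x)) slices) edge_facets"
  by code_simp

lemma slice_turn:
  "list_all (\<lambda>x. list_all (\<lambda>(i, v). 
       slice_facet i v (turn_facet x) = turn_facet (slice_facet i v x)) slices) corner_facets"
  by code_simp


section \<open>Words in the slice moves\<close>

lemma group_T_geom: "group T_geom"
  unfolding T_geom_def
  by (intro DirProd_group group_bundle_aut bundle_closed_edge_geom bundle_closed_corner_geom group_BijGroup)

lemma carrier_T_geom: "carrier T_geom =
    bundle_iso edge_geom edge_geom \<times> bundle_iso corner_geom corner_geom \<times> Bij CentGeom"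
  by (simp add: T_geom_def bundle_aut_def BijGroup_def)

lemma T_geom_mult:
  assumes "h \<in> Bij CentGeom" "h' \<in> Bij CentGeom"
  shows "(e, s, h) \<otimes>\<^bsub>T_geom\<^esub> (e', s', h')
    = (bundle_comp edge_geom e e', bundle_comp corner_geom s s', compose CentGeom h h')"
  using assms by (simp add: T_geom_def bundle_aut_def BijGroup_def)

definition edge_one where "edge_one = (\<lambda>c\<in>ArGeom. c, \<lambda>x\<in>geom_facets ArGeom. x)"
definition corner_one where "corner_one = (\<lambda>c\<in>SomGeom. c, \<lambda>x\<in>geom_facets SomGeom. x)"
definition centre_one where "centre_one = (\<lambda>c\<in>CentGeom. c)"

lemma T_geom_one: "\<one>\<^bsub>T_geom\<^esub> = (edge_one, corner_one, centre_one)"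
  by (simp add: T_geom_def bundle_aut_def BijGroup_def edge_one_def corner_one_def centre_one_def)

text \<open>One pair of maps on all cubies and facets encodes its restrictions to edges, corners and centres;
  composition of transformations then becomes composition of functions.\<close>

definition realise :: "(vec \<Rightarrow> vec) \<Rightarrow> (gfacet \<Rightarrow> gfacet) \<Rightarrow> geom_transf" where
  "realise C F =
     ((restrict C ArGeom, restrict F (geom_facets ArGeom)),
      (restrict C SomGeom, restrict F (geom_facets SomGeom)), restrict C CentGeom)"

definition cube_symmetry :: "(vec \<Rightarrow> vec) \<Rightarrow> (gfacet \<Rightarrow> gfacet) \<Rightarrow> bool" where
  "cube_symmetry C F \<longleftrightarrow> bij C \<and> bij F \<and>
     (\<forall>k\<in>{1, 2, 3}. \<forall>c\<in>cubies_with k. C c \<in> cubies_with k) \<and>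
     (\<forall>k\<in>{2, 3}. \<forall>x\<in>geom_facets (cubies_with k). F x \<in> geom_facets (cubies_with k)) \<and>
     (\<forall>x. fst (F x) = C (fst x)) \<and>
     (\<forall>x\<in>geom_facets ArGeom. F (edge_swap x) = edge_swap (F x)) \<and>
     (\<forall>x\<in>geom_facets SomGeom. F (turn_facet x) = turn_facet (F x)) \<and>
     (\<forall>c\<in>ArGeom. F (edge_section c) = edge_section (C c))"

lemma cube_symmetryD:
  assumes "cube_symmetry C F"
  shows "bij C" "bij F"
    "c \<in> ArGeom \<Longrightarrow> C c \<in> ArGeom" "c \<in> SomGeom \<Longrightarrow> C c \<in> SomGeom" "c \<in> CentGeom \<Longrightarrow> C c \<in> CentGeom"
    "x \<in> geom_facets ArGeom \<Longrightarrow> F x \<in> geom_facets ArGeom"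
    "x \<in> geom_facets SomGeom \<Longrightarrow> F x \<in> geom_facets SomGeom"
    "fst (F x) = C (fst x)"
    "x \<in> geom_facets ArGeom \<Longrightarrow> F (edge_swap x) = edge_swap (F x)"
    "x \<in> geom_facets SomGeom \<Longrightarrow> F (turn_facet x) = turn_facet (F x)"
    "c \<in> ArGeom \<Longrightarrow> F (edge_section c) = edge_section (C c)"
proof -
  have *: "\<And>k c. k \<in> {1, 2, 3} \<Longrightarrow> c \<in> cubies_with k \<Longrightarrow> C c \<in> cubies_with k"
    and **: "\<And>k x. k \<in> {2, 3} \<Longrightarrow> x \<in> geom_facets (cubies_with k) \<Longrightarrow> F x \<in> geom_facets (cubies_with k)"
    using assms unfolding cube_symmetry_def by blast+
  show "c \<in> ArGeom \<Longrightarrow> C c \<in> ArGeom" "c \<in> SomGeom \<Longrightarrow> C c \<in> SomGeom" "c \<in> CentGeom \<Longrightarrow> C c \<in> CentGeom"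
    "x \<in> geom_facets ArGeom \<Longrightarrow> F x \<in> geom_facets ArGeom"
    "x \<in> geom_facets SomGeom \<Longrightarrow> F x \<in> geom_facets SomGeom"
    unfolding ArGeom_def SomGeom_def CentGeom_def using * ** by simp_all
qed (use assms[unfolded cube_symmetry_def] in blast)+

lemma finite_pieces [simp]:
  "finite ArGeom" "finite SomGeom" "finite CentGeom"
  "finite (geom_facets ArGeom)" "finite (geom_facets SomGeom)"
  by (simp_all only: ArGeom_list SomGeom_list CentGeom_list ArFacets_list[unfolded ArGeom_list]
      SomFacets_list[unfolded SomGeom_list] finite_set)

lemma bij_betw_endo:
  assumes "finite A" "bij f" "\<And>x. x \<in> A \<Longrightarrow> f x \<in> A"
  shows "bij_betw f A A"
proof -
  have "inj_on f A" using assms(2) bij_is_inj inj_on_subset by blast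
  moreover have "f ` A = A"
    using endo_inj_surj[OF assms(1)] assms(3) calculation by blast
  ultimately show ?thesis by (auto simp: bij_betw_def inj_on_def)
qed

lemma section_facet:
  assumes "c \<in> ArGeom" shows "edge_section c \<in> geom_facets ArGeom"
proof -
  have "list_all (\<lambda>c. hd (section_normals c) \<in> set normal_list \<and> dot c (hd (section_normals c)) = 3) edges"
    by code_simp
  then show ?thesis
    using assms edge_section_exec[OF assms] geom_facets_iff[of c "hd (section_normals c)" ArGeom]
    by (simp add: ArGeom_list list_all_iff section_exec_def)
qed

text \<open>Equivariance determines an edge automorphism on both facets of an edge once it is known on the
  distinguished one.\<close>

lemma edge_facet_cases:
  assumes "x \<in> geom_facets ArGeom"
  shows "x = edge_section (fst x) \<or> x = edge_swap (edge_section (fst x))"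
proof -
  have "list_all (\<lambda>x. x = section_exec (fst x) \<or> x = swap_exec (section_exec (fst x))) edge_facets"
    by code_simp
  moreover have "fst x \<in> ArGeom" using assms by (auto simp: geom_facets_def)
  ultimately show ?thesis
    using assms section_facet[of "fst x"] edge_section_exec[of "fst x"] edge_swap_exec[of "edge_section (fst x)"]
    by (simp add: ArFacets_list list_all_iff)
qed

lemma realise_in_T_geom':
  assumes "cube_symmetry C F" shows "realise C F \<in> T_geom'"
proof -
  note sym = cube_symmetryD[OF assms]
  have "(restrict C ArGeom, restrict F (geom_facets ArGeom)) \<in> bundle_iso edge_geom edge_geom"
    using sym bundle_closed_edge_geom
    by (intro bundle_isoI) (simp_all add: bij_betw_endo bundle_closed_def)
  moreover have "(restrict C SomGeom, restrict F (geom_facets SomGeom)) \<in> bundle_iso corner_geom corner_geom"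
    using sym bundle_closed_corner_geom
    by (intro bundle_isoI) (simp_all add: bij_betw_endo bundle_closed_def)
  moreover have "restrict C CentGeom \<in> Bij CentGeom"
    using sym by (simp add: Bij_def bij_betw_endo)
  ultimately show ?thesis
    using sym by (simp add: T_geom'_def realise_def carrier_T_geom section_facet)
qed

lemma compose_restrict: "(\<And>x. x \<in> A \<Longrightarrow> g x \<in> A) \<Longrightarrow>
    compose A (restrict f A) (restrict g A) = restrict (f \<circ> g) A"
  by (auto simp: compose_def fun_eq_iff)

lemma T_geom'_subset: "T_geom' \<subseteq> carrier T_geom"
  by (auto simp: T_geom'_def)

lemma realise_mult:
  assumes "cube_symmetry C F" "cube_symmetry D G"
  shows "realise C F \<otimes>\<^bsub>T_geom\<^esub> realise D G = realise (C \<circ> D) (F \<circ> G)"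
proof -
  have "realise C F \<in> carrier T_geom" "realise D G \<in> carrier T_geom"
    using assms realise_in_T_geom' T_geom'_subset by blast+
  then have "restrict C CentGeom \<in> Bij CentGeom" "restrict D CentGeom \<in> Bij CentGeom"
    by (auto simp: carrier_T_geom realise_def)
  then show ?thesis
    using cube_symmetryD[OF assms(2)]
    by (simp add: realise_def T_geom_mult bundle_comp_def compose_restrict)
qed

lemma cube_symmetry_id: "cube_symmetry (\<lambda>c. c) (\<lambda>x. x)"
  by (simp add: cube_symmetry_def bij_def)

lemma cube_symmetry_comp:
  assumes "cube_symmetry C F" "cube_symmetry D G"
  shows "cube_symmetry (C \<circ> D) (F \<circ> G)"
  unfolding cube_symmetry_def
  using cube_symmetryD[OF assms(1)] cube_symmetryD[OF assms(2)] assms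
  by (intro conjI) (auto simp: bij_comp cube_symmetry_def)

lemma quarter_turn_simps [simp]:
  "coord i (quarter_turn i c) = coord i c"
  "quarter_turn i (quarter_turn i (quarter_turn i (quarter_turn i c))) = c"
  "dot (quarter_turn i c) (quarter_turn i d) = dot c d"
  by (cases i; cases c; cases d; simp)+

lemma slice_four:
  "slice_cubie i v (slice_cubie i v (slice_cubie i v (slice_cubie i v c))) = c"
  "slice_facet i v (slice_facet i v (slice_facet i v (slice_facet i v x))) = x"
  by (simp_all add: slice_cubie_def slice_facet_def split_beta)

lemma bij_slice: "bij (slice_cubie i v)" "bij (slice_facet i v)"
  by (rule bij_betw_byWitness[where f' = "slice_cubie i v \<circ> slice_cubie i v \<circ> slice_cubie i v"]
      bij_betw_byWitness[where f' = "slice_facet i v \<circ> slice_facet i v \<circ> slice_facet i v"];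
      simp add: slice_four)+

lemma quarter_turn_normal: "n \<in> normals \<Longrightarrow> quarter_turn i n \<in> normals"
proof -
  have "list_all (\<lambda>n. list_all (\<lambda>i. quarter_turn i n \<in> set normal_list) axis_list) normal_list"
    by code_simp
  then show "n \<in> normals \<Longrightarrow> quarter_turn i n \<in> normals"
    by (simp add: list_all_iff set_normal_list set_axis_list)
qed

lemma slices_iff: "(i, v) \<in> set slices \<longleftrightarrow> v \<in> {-3, -1, 1, 3}"
  by (auto simp: slices_def set_axis_list coord_list_def)

text \<open>That slices preserve the distinguished edge facets is where the inclusion of the legal moves in
  \<open>T_geom'\<close> comes from.\<close>

lemma slice_symmetry:
  assumes "(i, v) \<in> set slices"
  shows "cube_symmetry (slice_cubie i v) (slice_facet i v)"
proof -
  have cubie: "slice_cubie i v c \<in> cubies_with k" if "k \<in> {1, 2, 3}" "c \<in> cubies_with k" for k c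
  proof -
    have "is_cubie k (slice_cubie i v c)"
      using slice_cubies that assms set_cubie_list[of k] unfolding list_all_iff by fastforce
    then show ?thesis using that by (auto simp: is_cubie)
  qed
  have facet: "slice_facet i v x \<in> geom_facets (cubies_with k)"
    if "k \<in> {2, 3}" "x \<in> geom_facets (cubies_with k)" for k x
    using that cubie[of k "fst x"]
    by (cases x) (auto simp: geom_facets_def slice_facet_def slice_cubie_def quarter_turn_normal)
  have edge: "slice_facet i v x \<in> geom_facets ArGeom" if "x \<in> geom_facets ArGeom" for x
    using facet[of 2 x] that by (simp add: ArGeom_def)
  have cubie': "slice_cubie i v c \<in> ArGeom" if "c \<in> ArGeom" for c
    using cubie[of 2 c] that by (simp add: ArGeom_def)
  have 1: "slice_facet i v (edge_section c) = edge_section (slice_cubie i v c)" if "c \<in> ArGeom" for c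
    using slice_section that assms
    by (simp add: edge_section_exec cubie') (auto simp: ArGeom_list list_all_iff)
  have 2: "slice_facet i v (edge_swap x) = edge_swap (slice_facet i v x)" if "x \<in> geom_facets ArGeom" for x
    using slice_swap that assms
    by (simp add: edge_swap_exec edge) (auto simp: ArFacets_list list_all_iff)
  have 3: "slice_facet i v (turn_facet x) = turn_facet (slice_facet i v x)" if "x \<in> geom_facets SomGeom" for x
    using slice_turn that assms by (auto simp: SomFacets_list list_all_iff)
  have 4: "fst (slice_facet i v x) = slice_cubie i v (fst x)" for x
    by (cases x) (simp add: slice_facet_def slice_cubie_def)
  show ?thesis
    unfolding cube_symmetry_def using bij_slice cubie facet 1 2 3 4 by blast
qed

text \<open>Words are read as products: the last letter acts first. A slice move has order four, so inverses
  are third powers and no separate letters are needed.\<close>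

fun cubie_word :: "(axis \<times> int) list \<Rightarrow> vec \<Rightarrow> vec" where
  "cubie_word [] c = c"
| "cubie_word ((i, v) # w) c = slice_cubie i v (cubie_word w c)"

fun facet_word :: "(axis \<times> int) list \<Rightarrow> gfacet \<Rightarrow> gfacet" where
  "facet_word [] x = x"
| "facet_word ((i, v) # w) x = slice_facet i v (facet_word w x)"

definition word_move :: "(axis \<times> int) list \<Rightarrow> geom_transf" where
  "word_move w = realise (cubie_word w) (facet_word w)"

lemma slice_move_realise: "slice_move i v = realise (slice_cubie i v) (slice_facet i v)"
  by (simp add: slice_move_def realise_def)

lemma slice_move_legal: "(i, v) \<in> set slices \<Longrightarrow> slice_move i v \<in> legal"
  unfolding legal_def slices_iff by (rule generate.incl) blast

lemma word_move_symmetry_legal: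
  assumes "set w \<subseteq> set slices"
  shows "cube_symmetry (cubie_word w) (facet_word w) \<and> word_move w \<in> legal"
  using assms
proof (induction w)
  case Nil
  have "cubie_word [] = (\<lambda>c. c)" "facet_word [] = (\<lambda>x. x)"
    by (simp_all add: fun_eq_iff)
  then have "word_move [] = \<one>\<^bsub>T_geom\<^esub>"
    by (simp add: word_move_def realise_def T_geom_one edge_one_def corner_one_def centre_one_def)
  then show ?case
    using cube_symmetry_id by (simp add: legal_def generate.one fun_eq_iff)
next
  case (Cons iv w)
  obtain i v where iv: "iv = (i, v)" by fastforce
  have eq: "cubie_word (iv # w) = slice_cubie i v \<circ> cubie_word w"
    "facet_word (iv # w) = slice_facet i v \<circ> facet_word w"
    by (auto simp: iv)
  have iv': "(i, v) \<in> set slices" and w: "cube_symmetry (cubie_word w) (facet_word w)" "word_move w \<in> legal"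
    using Cons iv by auto
  have "word_move (iv # w) = slice_move i v \<otimes>\<^bsub>T_geom\<^esub> word_move w"
    unfolding word_move_def eq slice_move_realise
    by (rule realise_mult[symmetric, OF slice_symmetry[OF iv'] w(1)])
  moreover have "\<dots> \<in> legal"
    using slice_move_legal[OF iv'] w(2) unfolding legal_def by (rule generate.eng)
  ultimately show ?case
    using cube_symmetry_comp[OF slice_symmetry[OF iv'] w(1)] unfolding eq by (simp only: simp_thms)
qed

lemma subgroup_T_geom': "subgroup T_geom' T_geom"
proof -
  interpret group T_geom by (rule group_T_geom)
  show ?thesis
  proof (rule subgroupI)
    show "T_geom' \<subseteq> carrier T_geom" by (rule T_geom'_subset)
    have "realise (\<lambda>c. c) (\<lambda>x. x) \<in> T_geom'"
      using realise_in_T_geom' cube_symmetry_id by blast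
    then show "T_geom' \<noteq> {}" by blast
  next
    fix t assume t: "t \<in> T_geom'"
    then have t': "t \<in> carrier T_geom" using T_geom'_subset by blast
    obtain f F s h where tf: "t = ((f, F), s, h)" by (metis prod.exhaust)
    obtain g G s' h' where ti: "inv\<^bsub>T_geom\<^esub> t = ((g, G), s', h')" by (metis prod.exhaust)
    have carr: "inv\<^bsub>T_geom\<^esub> t \<in> carrier T_geom" using t' by simp
    have "(f, F) \<in> bundle_iso edge_geom edge_geom" and "(g, G) \<in> bundle_iso edge_geom edge_geom"
      and h: "h \<in> Bij CentGeom" "h' \<in> Bij CentGeom"
      using t'[unfolded tf] carr[unfolded ti] by (auto simp: carrier_T_geom)
    note iso = bundle_isoD[OF this(1)] bundle_isoD[OF this(2)]
    have "inv\<^bsub>T_geom\<^esub> t \<otimes>\<^bsub>T_geom\<^esub> t = \<one>\<^bsub>T_geom\<^esub>" "t \<otimes>\<^bsub>T_geom\<^esub> inv\<^bsub>T_geom\<^esub> t = \<one>\<^bsub>T_geom\<^esub>"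
      using t' by simp_all
    then have eqs: "compose ArGeom f g = (\<lambda>c\<in>ArGeom. c)"
      "compose (geom_facets ArGeom) G F = (\<lambda>x\<in>geom_facets ArGeom. x)"
      unfolding tf ti[unfolded tf]
      by (simp_all add: T_geom_mult h T_geom_one bundle_comp_def edge_one_def)
    have "G (edge_section c) = edge_section (g c)" if "c \<in> ArGeom" for c
    proof -
      have gc: "g c \<in> ArGeom" using iso(17) that by simp
      have "F (edge_section (g c)) = edge_section (f (g c))"
        using t gc by (simp add: tf T_geom'_def)
      moreover have "f (g c) = c" using eqs(1) that by (metis compose_eq restrict_apply')
      moreover have "G (F x) = x" if "x \<in> geom_facets ArGeom" for x
        using eqs(2) that by (metis compose_eq restrict_apply')
      ultimately show ?thesis using section_facet[OF gc] by metis
    qed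
    then show "inv\<^bsub>T_geom\<^esub> t \<in> T_geom'" using carr by (simp add: ti T_geom'_def)
  next
    fix t u assume tu: "t \<in> T_geom'" "u \<in> T_geom'"
    then have carr: "t \<in> carrier T_geom" "u \<in> carrier T_geom" using T_geom'_subset by blast+
    obtain f F s h where tf: "t = ((f, F), s, h)" by (metis prod.exhaust)
    obtain g G s' h' where ug: "u = ((g, G), s', h')" by (metis prod.exhaust)
    have "(g, G) \<in> bundle_iso edge_geom edge_geom"
      and h: "h \<in> Bij CentGeom" "h' \<in> Bij CentGeom"
      using carr by (auto simp: tf ug carrier_T_geom)
    note iso = bundle_isoD[OF this(1)]
    have "t \<otimes>\<^bsub>T_geom\<^esub> u \<in> carrier T_geom" using carr by simp
    then show "t \<otimes>\<^bsub>T_geom\<^esub> u \<in> T_geom'"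
      using tu iso(8) by (simp add: tf ug T_geom_mult h T_geom'_def bundle_comp_def compose_eq section_facet)
  qed
qed

lemma legal_subset_T_geom': "legal \<subseteq> T_geom'"
  unfolding legal_def
proof (rule group.generate_subgroup_incl[OF group_T_geom _ subgroup_T_geom'])
  show "{slice_move i v |i v. v \<in> {- 3, - 1, 1, 3}} \<subseteq> T_geom'"
    using realise_in_T_geom' slice_symmetry slices_iff by (auto simp: slice_move_realise)
qed

lemma subgroup_legal: "subgroup legal T_geom"
proof -
  have "{slice_move i v |i v. v \<in> {- 3, - 1, 1, 3}} \<subseteq> carrier T_geom"
    using legal_subset_T_geom' T_geom'_subset slice_move_legal slices_iff by blast
  then show ?thesis
    unfolding legal_def by (rule group.generate_is_subgroup[OF group_T_geom])
qed

text \<open>Cubies and transformations are tuples; quantifiers over them are kept unsplit.\<close>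

declare split_paired_All [simp del] split_paired_Ex [simp del]

section \<open>Even permutations of edges, corners and centres\<close>

interpretation T: group T_geom by (rule group_T_geom)

definition edge_perm :: "geom_transf \<Rightarrow> vec \<Rightarrow> vec" where "edge_perm t = fst (fst t)"
definition corner_part :: "geom_transf \<Rightarrow> (vec, gfacet, vec, gfacet) bundle_map"
  where "corner_part t = fst (snd t)"
definition centre_part :: "geom_transf \<Rightarrow> vec \<Rightarrow> vec" where "centre_part t = snd (snd t)"

lemma mult_parts:
  assumes "t \<in> carrier T_geom" "u \<in> carrier T_geom"
  shows "edge_perm (t \<otimes>\<^bsub>T_geom\<^esub> u) = compose ArGeom (edge_perm t) (edge_perm u)"
    "corner_part (t \<otimes>\<^bsub>T_geom\<^esub> u) = bundle_comp corner_geom (corner_part t) (corner_part u)"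
    "fst (corner_part (t \<otimes>\<^bsub>T_geom\<^esub> u)) = compose SomGeom (fst (corner_part t)) (fst (corner_part u))"
    "centre_part (t \<otimes>\<^bsub>T_geom\<^esub> u) = compose CentGeom (centre_part t) (centre_part u)"
  using assms
  by (auto simp: carrier_T_geom T_geom_mult bundle_comp_def edge_perm_def corner_part_def centre_part_def)

lemma parts_carrier:
  assumes "t \<in> carrier T_geom"
  shows "edge_perm t \<in> Bij ArGeom" "corner_part t \<in> bundle_iso corner_geom corner_geom"
    "fst (corner_part t) \<in> Bij SomGeom" "centre_part t \<in> Bij CentGeom"
  using assms
  by (auto simp: carrier_T_geom edge_perm_def corner_part_def centre_part_def Bij_def bundle_iso_def)

lemma one_parts:
  "edge_perm \<one>\<^bsub>T_geom\<^esub> = (\<lambda>c\<in>ArGeom. c)" "corner_part \<one>\<^bsub>T_geom\<^esub> = corner_one"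
  "centre_part \<one>\<^bsub>T_geom\<^esub> = centre_one"
  by (simp_all add: T_geom_one edge_perm_def corner_part_def centre_part_def edge_one_def)

lemma legal_carrier: "l \<in> legal \<Longrightarrow> l \<in> carrier T_geom"
  using legal_subset_T_geom' T_geom'_subset by blast

lemma legal_mult: "l \<in> legal \<Longrightarrow> m \<in> legal \<Longrightarrow> l \<otimes>\<^bsub>T_geom\<^esub> m \<in> legal"
  using subgroup.m_closed[OF subgroup_legal] .

lemma legal_inv: "l \<in> legal \<Longrightarrow> inv\<^bsub>T_geom\<^esub> l \<in> legal"
  using subgroup.m_inv_closed[OF subgroup_legal] .

lemma Bij_eqI:
  assumes "f \<in> Bij A" "\<And>c. c \<in> A \<Longrightarrow> f c = p c"
  shows "f = restrict p A"
  using assms by (intro extensionalityI[of _ A]) (auto simp: Bij_def)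

lemma Bij_permutes:
  assumes "f \<in> Bij A"
  obtains p where "p permutes A" "f = restrict p A"
proof
  let ?p = "\<lambda>x. if x \<in> A then f x else x"
  have "bij_betw ?p A A \<longleftrightarrow> bij_betw f A A" by (rule bij_betw_cong) simp
  then show "?p permutes A" using assms by (intro bij_imp_permutes) (auto simp: Bij_def)
  show "f = restrict ?p A" using assms by (intro Bij_eqI) auto
qed

text \<open>Every rotation of the cube is a product of quarter turns about the three axes in a fixed order (Euler angles);
  the list contains repetitions.\<close>

definition rotations :: "vec \<Rightarrow> vec list" where
  "rotations x = concat (map (\<lambda>i. concat (map (\<lambda>j. map (\<lambda>k.
     (quarter_turn E1 ^^ i) ((quarter_turn E2 ^^ j) ((quarter_turn E3 ^^ k) x))) [0..<4]) [0..<4])) [0..<4])"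

lemma rotations_closed:
  assumes turn: "\<And>i c. c \<in> B \<Longrightarrow> quarter_turn i c \<in> B" and "x \<in> B"
  shows "set (rotations x) \<subseteq> B"
proof -
  have pow: "(quarter_turn i ^^ m) c \<in> B" if "c \<in> B" for i m c
    using that turn by (induction m) auto
  show ?thesis
    by (auto simp: rotations_def simp del: split_paired_all intro!: pow \<open>x \<in> B\<close>)
qed

definition list_subset :: "vec list \<Rightarrow> vec list \<Rightarrow> bool" where
  "list_subset xs ys \<longleftrightarrow> list_all (\<lambda>x. x \<in> set ys) xs"

text \<open>The common situation of edges, corners and centres. \<open>A\<close> is the set of pieces on which the legal moves
  act through \<open>\<rho>\<close>. \<open>N\<close> is a normal submonoid of legal moves, with trivial effect on the
  other kinds of pieces when that matters, containing an element that acts on \<open>A\<close> as the three-cycle \<open>(x y z)\<close>. No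
  slice contains all of \<open>x\<close>, \<open>y\<close>, \<open>z\<close>, so that every slice move fixes one of them.\<close>

locale slice_action =
  fixes A :: "vec set" and N :: "geom_transf set" and \<rho> :: "geom_transf \<Rightarrow> vec \<Rightarrow> vec" and x y z :: vec
  assumes finite: "finite A"
    and slices: "\<And>i c. c \<in> A \<Longrightarrow> (i, coord i c) \<in> set slices"
    and slice_closed: "\<And>i v c. (i, v) \<in> set slices \<Longrightarrow> c \<in> A \<Longrightarrow> slice_cubie i v c \<in> A"
    and N: "N \<subseteq> legal" "\<one>\<^bsub>T_geom\<^esub> \<in> N"
    and N_mult: "\<And>t u. t \<in> N \<Longrightarrow> u \<in> N \<Longrightarrow> t \<otimes>\<^bsub>T_geom\<^esub> u \<in> N"
    and N_conj: "\<And>l t. l \<in> legal \<Longrightarrow> t \<in> N \<Longrightarrow> l \<otimes>\<^bsub>T_geom\<^esub> t \<otimes>\<^bsub>T_geom\<^esub> inv\<^bsub>T_geom\<^esub> l \<in> N"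
    and \<rho>_Bij: "\<And>t. t \<in> legal \<Longrightarrow> \<rho> t \<in> Bij A"
    and \<rho>_mult: "\<And>t u. t \<in> legal \<Longrightarrow> u \<in> legal \<Longrightarrow> \<rho> (t \<otimes>\<^bsub>T_geom\<^esub> u) = compose A (\<rho> t) (\<rho> u)"
    and \<rho>_one: "\<rho> \<one>\<^bsub>T_geom\<^esub> = (\<lambda>c\<in>A. c)"
    and \<rho>_slice: "\<And>i v. \<rho> (slice_move i v) = restrict (slice_cubie i v) A"
    and seed_N: "\<exists>t\<in>N. \<rho> t = restrict (cyc3 x y z) A"
    and seed: "x \<in> A" "y \<in> A" "z \<in> A" "distinct [x, y, z]"
    and seed_slices: "list_all (\<lambda>(i, v). slice_cubie i v x = x \<or> slice_cubie i v y = y \<or> slice_cubie i v z = z) slices"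
    and orbit: "A \<subseteq> set (rotations x)"
begin

definition H where "H = {p. p permutes A \<and> (\<exists>t\<in>N. \<rho> t = restrict p A)}"

lemma H_comp: "p \<in> H \<Longrightarrow> q \<in> H \<Longrightarrow> p \<circ> q \<in> H"
proof -
  assume "p \<in> H" "q \<in> H"
  then obtain t u where tu: "p permutes A" "q permutes A" "t \<in> N" "u \<in> N"
    "\<rho> t = restrict p A" "\<rho> u = restrict q A" by (auto simp: H_def)
  then have "\<rho> (t \<otimes>\<^bsub>T_geom\<^esub> u) = restrict (p \<circ> q) A"
    using \<rho>_mult[of t u] subsetD[OF N(1)] by (simp add: compose_restrict permutes_in_image)
  then show ?thesis
    using tu N_mult permutes_compose[of q A p] unfolding H_def by blast
qed

lemma H_id: "id \<in> H"
proof -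
  have "\<rho> \<one>\<^bsub>T_geom\<^esub> = restrict id A" by (simp add: \<rho>_one id_def)
  then show ?thesis using N(2) permutes_id[of A] unfolding H_def by blast
qed

sublocale cyc3_closed H by unfold_locales (rule H_comp)

lemma cyc3_permutes: "a \<in> A \<Longrightarrow> b \<in> A \<Longrightarrow> c \<in> A \<Longrightarrow> cyc3 a b c permutes A"
  unfolding cyc3_def by (intro permutes_compose permutes_swap_id)

lemma cyc3_support:
  assumes "distinct [u, v, w]" "cyc3 u v w \<in> H"
  shows "{u, v, w} \<subseteq> A"
proof -
  have "cyc3 u v w permutes A" using assms(2) by (simp add: H_def)
  moreover have "cyc3 u v w u \<noteq> u" "cyc3 u v w v \<noteq> v" "cyc3 u v w w \<noteq> w"
    using assms(1) by (auto simp: cyc3_apply)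
  ultimately show ?thesis using permutes_not_in[of "cyc3 u v w" A] by blast
qed

text \<open>Conjugation by the slice move inside \<open>N\<close> induces conjugation of the three-cycle.\<close>

lemma slice_conj:
  assumes iv: "(i, v) \<in> set slices" and uvw: "distinct [a, b, c]" "cyc3 a b c \<in> H"
  shows "cyc3 (slice_cubie i v a) (slice_cubie i v b) (slice_cubie i v c) \<in> H
    \<and> distinct [slice_cubie i v a, slice_cubie i v b, slice_cubie i v c]"
proof
  let ?g = "slice_cubie i v" and ?l = "slice_move i v"
  have inj: "?g p = ?g q \<longleftrightarrow> p = q" for p q
    using bij_slice(1)[of i v] by (simp add: bij_def inj_eq)
  show dist: "distinct [?g a, ?g b, ?g c]" using uvw(1) by (simp add: inj)
  obtain t where t: "t \<in> N" "\<rho> t = restrict (cyc3 a b c) A" using uvw(2) by (auto simp: H_def)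
  have abc: "a \<in> A" "b \<in> A" "c \<in> A" using cyc3_support[OF uvw] by auto
  define t' where "t' = ?l \<otimes>\<^bsub>T_geom\<^esub> t \<otimes>\<^bsub>T_geom\<^esub> inv\<^bsub>T_geom\<^esub> ?l"
  have l: "?l \<in> legal" using slice_move_legal[OF iv] .
  have t': "t' \<in> N" unfolding t'_def using N_conj[OF l t(1)] .
  have tl: "t \<in> legal" "t' \<in> legal" using t t' N by auto
  have "t' \<otimes>\<^bsub>T_geom\<^esub> ?l = ?l \<otimes>\<^bsub>T_geom\<^esub> t"
    unfolding t'_def using l tl(1) legal_carrier by (simp add: T.m_assoc)
  then have eq: "compose A (\<rho> t') (restrict ?g A) = compose A (restrict ?g A) (restrict (cyc3 a b c) A)"
    using \<rho>_mult[OF tl(2) l] \<rho>_mult[OF l tl(1)] by (simp add: \<rho>_slice t(2))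
  have perm: "cyc3 a b c permutes A" using cyc3_permutes abc by blast
  have "\<rho> t' (?g d) = cyc3 (?g a) (?g b) (?g c) (?g d)" if "d \<in> A" for d
  proof -
    have "\<rho> t' (?g d) = ?g (cyc3 a b c d)"
      using fun_cong[OF eq, of d] that permutes_in_image[OF perm, of d] by (simp add: compose_eq)
    then show ?thesis using uvw(1) dist by (simp add: cyc3_apply inj)
  qed
  moreover have "\<exists>d\<in>A. e = ?g d" if "e \<in> A" for e
  proof -
    have "?g ` A = A" using bij_betw_endo[OF finite bij_slice(1)] slice_closed[OF iv]
      by (simp add: bij_betw_def)
    then show ?thesis using that by blast
  qed
  ultimately have "\<rho> t' e = cyc3 (?g a) (?g b) (?g c) e" if "e \<in> A" for e using that by metis
  then have "\<rho> t' = restrict (cyc3 (?g a) (?g b) (?g c)) A"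
    using Bij_eqI \<rho>_Bij tl(2) by blast
  moreover have "cyc3 (?g a) (?g b) (?g c) permutes A"
    using cyc3_permutes slice_closed[OF iv] abc by blast
  ultimately show "cyc3 (?g a) (?g b) (?g c) \<in> H" using t' unfolding H_def by blast
qed

lemma all_three_cycles:
  assumes "a \<in> A" "b \<in> A" "c \<in> A" "distinct [a, b, c]"
  shows "cyc3 a b c \<in> H"
proof (rule all_cyc3_from_seed[where S = A and x = x and y = y and z = z and G = "(\<lambda>(i, v). slice_cubie i v) ` set slices"])
  show "cyc3 x y z \<in> H"
    unfolding H_def using seed_N seed cyc3_permutes by blast
  show "A \<subseteq> B" if "x \<in> B" and
    closed: "\<And>g u. g \<in> (\<lambda>(i, v). slice_cubie i v) ` set slices \<Longrightarrow> u \<in> B \<Longrightarrow> g u \<in> B" for B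
  proof -
    \<comment> \<open>Each cubie lies in a slice perpendicular to each axis, so stability under slice moves is stability
      under all rotations of the cube.\<close>
    have "quarter_turn i d \<in> A \<inter> B" if "d \<in> A \<inter> B" for i d
    proof -
      have "(i, coord i d) \<in> set slices" using slices that by blast
      then have "slice_cubie i (coord i d) d \<in> A" "slice_cubie i (coord i d) d \<in> B"
        using slice_closed that closed[OF image_eqI[of _ _ "(i, coord i d)"], of "slice_cubie i (coord i d)" d]
        by auto
      then show ?thesis by (simp add: slice_cubie_def)
    qed
    then have "set (rotations x) \<subseteq> A \<inter> B" by (rule rotations_closed) (use that(1) seed(1) in auto)
    with orbit show ?thesis by blast
  qed
  show "cyc3 (g u) (g v) (g w) \<in> H \<and> distinct [g u, g v, g w]"
    if g: "g \<in> (\<lambda>(i, v). slice_cubie i v) ` set slices" and "distinct [u, v, w]" "cyc3 u v w \<in> H" for g u v w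
  proof -
    obtain i k where "(i, k) \<in> set slices" "g = slice_cubie i k" using g by auto
    then show ?thesis using slice_conj that(2,3) by blast
  qed
  show "g x = x \<or> g y = y \<or> g z = z" if g: "g \<in> (\<lambda>(i, v). slice_cubie i v) ` set slices" for g
    using seed_slices g by (auto simp: list_all_iff simp del: split_paired_All)
qed (use seed(4) assms cyc3_support in blast)+

theorem even_permutations:
  assumes "p permutes A" "evenperm p"
  shows "\<exists>t\<in>N. \<rho> t = restrict p A"
proof -
  have "p \<in> H"
    using evenperm_in_three_cycle_closure[of H A p] H_comp H_id all_three_cycles finite assms by blast
  then show ?thesis by (simp add: H_def)
qed

end

section \<open>Legal three-cycles\<close>

definition inverse_word :: "(axis \<times> int) list \<Rightarrow> (axis \<times> int) list" where
  "inverse_word w = concat (map (\<lambda>m. [m, m, m]) (rev w))"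

definition commutator_word :: "(axis \<times> int) list \<Rightarrow> (axis \<times> int) list \<Rightarrow> (axis \<times> int) list" where
  "commutator_word u w = u @ w @ inverse_word u @ inverse_word w"

text \<open>The seeds are commutators of a slice move \<open>u\<close> with a conjugate \<open>w\<close> of another one or its inverse. The pieces moved by both
  \<open>u\<close> and \<open>w\<close> are so few that the commutator is a three-cycle: for \<open>edge_word\<close> and \<open>centre_word\<close>
  it moves nothing else, and for \<open>corner_word\<close> only its effect on the corners is used.\<close>

definition edge_word where
  "edge_word = commutator_word [(E1, -3)] ([(E2, -3), (E1, -1)] @ inverse_word [(E2, -3)])"

definition centre_word where
  "centre_word = commutator_word [(E1, -3)] ([(E2, -1), (E1, -1)] @ inverse_word [(E2, -1)])"

definition corner_word where
  "corner_word = commutator_word [(E1, -3)] (inverse_word [(E2, -3)] @ inverse_word [(E1, 3)] @ [(E2, -3)])"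

definition cyc_exec :: "vec \<Rightarrow> vec \<Rightarrow> vec \<Rightarrow> vec \<Rightarrow> vec" where
  "cyc_exec a b c x = (if x = a then b else if x = b then c else if x = c then a else x)"

text \<open>These predicates are constants applied to cubies and facets, not abstractions over them: evaluating a word
  at a variable would multiply the unresolved case distinctions, one for each letter.\<close>

definition acts_on_cubie :: "(axis \<times> int) list \<Rightarrow> (vec \<Rightarrow> vec) \<Rightarrow> vec \<Rightarrow> bool" where
  "acts_on_cubie w f c \<longleftrightarrow> cubie_word w c = f c"

definition fixes_facet :: "(axis \<times> int) list \<Rightarrow> gfacet \<Rightarrow> bool" where
  "fixes_facet w x \<longleftrightarrow> facet_word w x = x"

lemma edge_word_eval:
  "list_all (acts_on_cubie edge_word (cyc_exec (-3, -3, 1) (-3, -1, -3) (-1, 3, -3))) edges"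
  "list_all (acts_on_cubie edge_word id) corners"
  "list_all (fixes_facet edge_word) corner_facets"
  "list_all (acts_on_cubie edge_word id) centres"
  by code_simp+

lemma centre_word_eval:
  "list_all (acts_on_cubie centre_word id) edges"
  "list_all (acts_on_cubie centre_word id) corners"
  "list_all (fixes_facet centre_word) corner_facets"
  "list_all (acts_on_cubie centre_word (cyc_exec (-3, -1, -1) (-1, 3, -1) (-3, -1, 1))) centres"
  by code_simp+

lemma corner_word_eval:
  "list_all (acts_on_cubie corner_word (cyc_exec (-3, -3, -3) (3, 3, 3) (-3, -3, 3))) corners"
  by code_simp

lemma rotation_orbits:
  "list_subset edges (rotations (-3, -3, 1))"
  "list_subset centres (rotations (-3, -1, -1))"
  "list_subset corners (rotations (-3, -3, -3))"
  by code_simp+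

lemma seed_slices_eval:
  "list_all (\<lambda>(i, v). slice_cubie i v (-3, -3, 1) = (-3, -3, 1) \<or> slice_cubie i v (-3, -1, -3) = (-3, -1, -3)
    \<or> slice_cubie i v (-1, 3, -3) = (-1, 3, -3)) slices"
  "list_all (\<lambda>(i, v). slice_cubie i v (-3, -1, -1) = (-3, -1, -1) \<or> slice_cubie i v (-1, 3, -1) = (-1, 3, -1)
    \<or> slice_cubie i v (-3, -1, 1) = (-3, -1, 1)) slices"
  "list_all (\<lambda>(i, v). slice_cubie i v (-3, -3, -3) = (-3, -3, -3) \<or> slice_cubie i v (3, 3, 3) = (3, 3, 3)
    \<or> slice_cubie i v (-3, -3, 3) = (-3, -3, 3)) slices"
  by code_simp+

text \<open>The three components of a transformation are multiplicative, each in its own composition \<open>g\<close>; the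
  transformations trivial under such a component \<open>f\<close> form a normal submonoid.\<close>

lemma kernel_mult:
  assumes hom: "\<forall>t\<in>carrier T_geom. \<forall>u\<in>carrier T_geom. f (t \<otimes>\<^bsub>T_geom\<^esub> u) = g (f t) (f u)"
    and "t \<in> carrier T_geom" "u \<in> carrier T_geom" "f t = f \<one>\<^bsub>T_geom\<^esub>" "f u = f \<one>\<^bsub>T_geom\<^esub>"
  shows "f (t \<otimes>\<^bsub>T_geom\<^esub> u) = f \<one>\<^bsub>T_geom\<^esub>"
  using assms bspec[OF bspec[OF hom T.one_closed] T.one_closed] by simp

lemma kernel_conj:
  assumes hom: "\<forall>t\<in>carrier T_geom. \<forall>u\<in>carrier T_geom. f (t \<otimes>\<^bsub>T_geom\<^esub> u) = g (f t) (f u)"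
    and l: "l \<in> carrier T_geom" and t: "t \<in> carrier T_geom" and ft: "f t = f \<one>\<^bsub>T_geom\<^esub>"
  shows "f (l \<otimes>\<^bsub>T_geom\<^esub> t \<otimes>\<^bsub>T_geom\<^esub> inv\<^bsub>T_geom\<^esub> l) = f \<one>\<^bsub>T_geom\<^esub>"
proof -
  have "f (l \<otimes>\<^bsub>T_geom\<^esub> u \<otimes>\<^bsub>T_geom\<^esub> inv\<^bsub>T_geom\<^esub> l) = g (g (f l) (f u)) (f (inv\<^bsub>T_geom\<^esub> l))"
    if "u \<in> carrier T_geom" for u
    using l that by (simp only: bspec[OF bspec[OF hom]] T.m_closed T.inv_closed)
  from this[OF t] this[OF T.one_closed] show ?thesis using l ft by simp
qed

lemma parts_hom:
  "\<forall>t\<in>carrier T_geom. \<forall>u\<in>carrier T_geom. edge_perm (t \<otimes>\<^bsub>T_geom\<^esub> u) = compose ArGeom (edge_perm t) (edge_perm u)"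
  "\<forall>t\<in>carrier T_geom. \<forall>u\<in>carrier T_geom.
    corner_part (t \<otimes>\<^bsub>T_geom\<^esub> u) = bundle_comp corner_geom (corner_part t) (corner_part u)"
  "\<forall>t\<in>carrier T_geom. \<forall>u\<in>carrier T_geom.
    centre_part (t \<otimes>\<^bsub>T_geom\<^esub> u) = compose CentGeom (centre_part t) (centre_part u)"
  by (intro ballI mult_parts; assumption)+

lemmas edge_kernel_mult = kernel_mult[where f = edge_perm, OF parts_hom(1)]
  and corner_kernel_mult = kernel_mult[where f = corner_part, OF parts_hom(2)]
  and centre_kernel_mult = kernel_mult[where f = centre_part, OF parts_hom(3)]
  and edge_kernel_conj = kernel_conj[where f = edge_perm, OF parts_hom(1)]
  and corner_kernel_conj = kernel_conj[where f = corner_part, OF parts_hom(2)]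
  and centre_kernel_conj = kernel_conj[where f = centre_part, OF parts_hom(3)]

lemma coord_slices: "c \<in> cubies_with k \<Longrightarrow> (i, coord i c) \<in> set slices"
  by (simp add: cubies_with_def cubies_def slices_iff)

lemma word_parts:
  "edge_perm (word_move w) = restrict (cubie_word w) ArGeom"
  "corner_part (word_move w) = (restrict (cubie_word w) SomGeom, restrict (facet_word w) (geom_facets SomGeom))"
  "centre_part (word_move w) = restrict (cubie_word w) CentGeom"
  by (simp_all add: word_move_def realise_def edge_perm_def corner_part_def centre_part_def)

lemma slice_parts:
  "edge_perm (slice_move i v) = restrict (slice_cubie i v) ArGeom"
  "corner_part (slice_move i v) = (restrict (slice_cubie i v) SomGeom, restrict (slice_facet i v) (geom_facets SomGeom))"
  "centre_part (slice_move i v) = restrict (slice_cubie i v) CentGeom"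
  by (simp_all add: slice_move_def edge_perm_def corner_part_def centre_part_def)

lemma restrict_cubie_word:
  assumes "list_all (acts_on_cubie w f) cs"
  shows "restrict (cubie_word w) (set cs) = restrict f (set cs)"
  using assms by (intro restrict_ext) (simp add: list_all_iff acts_on_cubie_def)

lemma restrict_facet_word:
  assumes "list_all (fixes_facet w) xs"
  shows "restrict (facet_word w) (set xs) = restrict (\<lambda>x. x) (set xs)"
  using assms by (intro restrict_ext) (simp add: list_all_iff fixes_facet_def)

lemma cyc_exec: "distinct [a, b, c] \<Longrightarrow> cyc_exec a b c = cyc3 a b c"
  by (rule ext) (simp only: cyc_exec_def cyc3_apply)

lemma words_in_slices:
  "set edge_word \<subseteq> set slices" "set centre_word \<subseteq> set slices" "set corner_word \<subseteq> set slices"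
  by code_simp+

lemma edge_word_parts:
  "edge_perm (word_move edge_word) = restrict (cyc3 (-3, -3, 1) (-3, -1, -3) (-1, 3, -3)) ArGeom"
  "corner_part (word_move edge_word) = corner_part \<one>\<^bsub>T_geom\<^esub>"
  "centre_part (word_move edge_word) = centre_part \<one>\<^bsub>T_geom\<^esub>"
  using restrict_cubie_word[OF edge_word_eval(1)] restrict_cubie_word[OF edge_word_eval(2)]
    restrict_facet_word[OF edge_word_eval(3)] restrict_cubie_word[OF edge_word_eval(4)]
  by (simp_all add: word_parts one_parts corner_one_def centre_one_def ArGeom_list[symmetric] id_def
      SomGeom_list[symmetric] SomFacets_list[symmetric] CentGeom_list[symmetric] cyc_exec)

lemma centre_word_parts:
  "edge_perm (word_move centre_word) = edge_perm \<one>\<^bsub>T_geom\<^esub>"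
  "corner_part (word_move centre_word) = corner_part \<one>\<^bsub>T_geom\<^esub>"
  "centre_part (word_move centre_word) = restrict (cyc3 (-3, -1, -1) (-1, 3, -1) (-3, -1, 1)) CentGeom"
  using restrict_cubie_word[OF centre_word_eval(1)] restrict_cubie_word[OF centre_word_eval(2)]
    restrict_facet_word[OF centre_word_eval(3)] restrict_cubie_word[OF centre_word_eval(4)]
  by (simp_all add: word_parts one_parts corner_one_def centre_one_def ArGeom_list[symmetric] id_def
      SomGeom_list[symmetric] SomFacets_list[symmetric] CentGeom_list[symmetric] cyc_exec)

lemma corner_word_parts:
  "fst (corner_part (word_move corner_word)) = restrict (cyc3 (-3, -3, -3) (3, 3, 3) (-3, -3, 3)) SomGeom"
  using restrict_cubie_word[OF corner_word_eval(1)]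
  by (simp add: word_parts SomGeom_list[symmetric] cyc_exec)

definition pure_edge_moves :: "geom_transf set" where
  "pure_edge_moves = {t \<in> legal. corner_part t = corner_part \<one>\<^bsub>T_geom\<^esub> \<and> centre_part t = centre_part \<one>\<^bsub>T_geom\<^esub>}"

definition pure_centre_moves :: "geom_transf set" where
  "pure_centre_moves = {t \<in> legal. edge_perm t = edge_perm \<one>\<^bsub>T_geom\<^esub> \<and> corner_part t = corner_part \<one>\<^bsub>T_geom\<^esub>}"

lemma seed_pieces:
  "(-3, -3, 1) \<in> ArGeom" "(-3, -1, -3) \<in> ArGeom" "(-1, 3, -3) \<in> ArGeom"
  "(-3, -1, -1) \<in> CentGeom" "(-1, 3, -1) \<in> CentGeom" "(-3, -1, 1) \<in> CentGeom"
  "(-3, -3, -3) \<in> SomGeom" "(3, 3, 3) \<in> SomGeom" "(-3, -3, 3) \<in> SomGeom"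
  unfolding ArGeom_list CentGeom_list SomGeom_list by code_simp+

lemma one_legal: "\<one>\<^bsub>T_geom\<^esub> \<in> legal"
  using subgroup.one_closed[OF subgroup_legal] .

interpretation edge: slice_action ArGeom pure_edge_moves edge_perm "(-3, -3, 1)" "(-3, -1, -3)" "(-1, 3, -3)"
proof
  show "\<exists>t\<in>pure_edge_moves. edge_perm t = restrict (cyc3 (-3, -3, 1) (-3, -1, -3) (-1, 3, -3)) ArGeom"
    using edge_word_parts word_move_symmetry_legal[OF words_in_slices(1)]
    by (intro bexI[of _ "word_move edge_word"]) (simp_all add: pure_edge_moves_def)
  show "t \<otimes>\<^bsub>T_geom\<^esub> u \<in> pure_edge_moves" if "t \<in> pure_edge_moves" "u \<in> pure_edge_moves" for t u
    using that legal_mult[of t u] corner_kernel_mult[of t u] centre_kernel_mult[of t u]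
    unfolding pure_edge_moves_def by (simp add: legal_carrier)
  show "l \<otimes>\<^bsub>T_geom\<^esub> t \<otimes>\<^bsub>T_geom\<^esub> inv\<^bsub>T_geom\<^esub> l \<in> pure_edge_moves"
    if "l \<in> legal" "t \<in> pure_edge_moves" for l t
    using that legal_mult legal_inv corner_kernel_conj[of l t] centre_kernel_conj[of l t]
    unfolding pure_edge_moves_def by (simp add: legal_carrier)
  show "ArGeom \<subseteq> set (rotations (- 3, - 3, 1))"
    using rotation_orbits(1) by (auto simp: list_subset_def list_all_iff ArGeom_list)
  show "(i, coord i c) \<in> set slices" if "c \<in> ArGeom" for i c
    using that coord_slices by (simp add: ArGeom_def)
  show "slice_cubie i v c \<in> ArGeom" if "(i, v) \<in> set slices" "c \<in> ArGeom" for i v c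
    using cube_symmetryD(3)[OF slice_symmetry] that by blast
qed (use one_legal seed_slices_eval(1) seed_pieces in \<open>auto simp: pure_edge_moves_def parts_carrier legal_carrier
    mult_parts one_parts slice_parts\<close>)

interpretation centre: slice_action CentGeom pure_centre_moves centre_part "(-3, -1, -1)" "(-1, 3, -1)" "(-3, -1, 1)"
proof
  show "\<exists>t\<in>pure_centre_moves. centre_part t = restrict (cyc3 (-3, -1, -1) (-1, 3, -1) (-3, -1, 1)) CentGeom"
    using centre_word_parts word_move_symmetry_legal[OF words_in_slices(2)]
    by (intro bexI[of _ "word_move centre_word"]) (simp_all add: pure_centre_moves_def)
  show "t \<otimes>\<^bsub>T_geom\<^esub> u \<in> pure_centre_moves" if "t \<in> pure_centre_moves" "u \<in> pure_centre_moves" for t u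
    using that legal_mult[of t u] edge_kernel_mult[of t u] corner_kernel_mult[of t u]
    unfolding pure_centre_moves_def by (simp add: legal_carrier)
  show "l \<otimes>\<^bsub>T_geom\<^esub> t \<otimes>\<^bsub>T_geom\<^esub> inv\<^bsub>T_geom\<^esub> l \<in> pure_centre_moves"
    if "l \<in> legal" "t \<in> pure_centre_moves" for l t
    using that legal_mult legal_inv edge_kernel_conj[of l t] corner_kernel_conj[of l t]
    unfolding pure_centre_moves_def by (simp add: legal_carrier)
  show "CentGeom \<subseteq> set (rotations (- 3, - 1, - 1))"
    using rotation_orbits(2) by (auto simp: list_subset_def list_all_iff CentGeom_list)
  show "(i, coord i c) \<in> set slices" if "c \<in> CentGeom" for i c
    using that coord_slices by (simp add: CentGeom_def)
  show "slice_cubie i v c \<in> CentGeom" if "(i, v) \<in> set slices" "c \<in> CentGeom" for i v c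
    using cube_symmetryD(5)[OF slice_symmetry] that by blast
qed (use one_legal seed_slices_eval(2) seed_pieces in \<open>auto simp: pure_centre_moves_def parts_carrier legal_carrier
    mult_parts one_parts slice_parts centre_one_def\<close>)

interpretation corner: slice_action SomGeom legal "\<lambda>t. fst (corner_part t)" "(-3, -3, -3)" "(3, 3, 3)" "(-3, -3, 3)"
proof
  show "\<exists>t\<in>legal. fst (corner_part t) = restrict (cyc3 (-3, -3, -3) (3, 3, 3) (-3, -3, 3)) SomGeom"
    using corner_word_parts word_move_symmetry_legal[OF words_in_slices(3)] by blast
  show "SomGeom \<subseteq> set (rotations (- 3, - 3, - 3))"
    using rotation_orbits(3) by (auto simp: list_subset_def list_all_iff SomGeom_list)
  show "(i, coord i c) \<in> set slices" if "c \<in> SomGeom" for i c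
    using that coord_slices by (simp add: SomGeom_def)
  show "slice_cubie i v c \<in> SomGeom" if "(i, v) \<in> set slices" "c \<in> SomGeom" for i v c
    using cube_symmetryD(4)[OF slice_symmetry] that by blast
  show "fst (corner_part (t \<otimes>\<^bsub>T_geom\<^esub> u)) = compose SomGeom (fst (corner_part t)) (fst (corner_part u))"
    if "t \<in> legal" "u \<in> legal" for t u
    using that by (intro mult_parts(3) legal_carrier)
qed (use one_legal seed_slices_eval(3) seed_pieces in \<open>auto simp: parts_carrier legal_carrier legal_mult legal_inv
    one_parts slice_parts corner_one_def\<close>)

text \<open>Four-cycles supply the odd permutations: slice moves act on each kind of piece as products
  of disjoint four-cycles.\<close>

definition cyc4 :: "'a \<Rightarrow> 'a \<Rightarrow> 'a \<Rightarrow> 'a \<Rightarrow> 'a \<Rightarrow> 'a" where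
  "cyc4 a b c d = transpose a b \<circ> (transpose b c \<circ> transpose c d)"

lemma cyc4_odd:
  assumes "distinct [a, b, c, d]"
  shows "permutation (cyc4 a b c d)" "\<not> evenperm (cyc4 a b c d)"
  using assms unfolding cyc4_def
  by (simp_all only: permutation_compose permutation_swap_id evenperm_comp evenperm_swap) auto

lemma cyc4_permutes: "{a, b, c, d} \<subseteq> S \<Longrightarrow> cyc4 a b c d permutes S"
  unfolding cyc4_def by (intro permutes_compose permutes_swap_id) auto

definition acts_as :: "(vec \<Rightarrow> vec) \<Rightarrow> (vec \<Rightarrow> vec) \<Rightarrow> vec \<Rightarrow> bool" where
  "acts_as f g c \<longleftrightarrow> f c = g c"

lemma inner_slice_eval:
  "list_all (acts_as (slice_cubie E1 1) (cyc4 (1, 3, 3) (1, -3, 3) (1, -3, -3) (1, 3, -3))) edges"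
  "list_all (acts_as (slice_cubie E1 1) id) corners"
  "list_all (\<lambda>x. slice_facet E1 1 x = x) corner_facets"
  "list_all (acts_as (slice_cubie E1 1) (cyc4 (1, 3, 1) (1, -1, 3) (1, -3, -1) (1, 1, -3)
      \<circ> cyc4 (1, 3, -1) (1, 1, 3) (1, -3, 1) (1, -1, -3))) centres"
  by code_simp+

lemma face_eval:
  "list_all (acts_as (slice_cubie E1 3) (cyc4 (3, 3, 3) (3, -3, 3) (3, -3, -3) (3, 3, -3))) corners"
  by code_simp

lemma restrict_acts_as:
  assumes "list_all (acts_as f g) cs"
  shows "restrict f (set cs) = restrict g (set cs)"
  using assms by (intro restrict_ext) (simp add: list_all_iff acts_as_def)

lemma cyc4_pieces:
  "{(1, 3, 3), (1, -3, 3), (1, -3, -3), (1, 3, -3)} \<subseteq> ArGeom"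
  "{(1, 3, 1), (1, -1, 3), (1, -3, -1), (1, 1, -3)} \<subseteq> CentGeom"
  "{(1, 3, -1), (1, 1, 3), (1, -3, 1), (1, -1, -3)} \<subseteq> CentGeom"
  "{(3, 3, 3), (3, -3, 3), (3, -3, -3), (3, 3, -3)} \<subseteq> SomGeom"
  unfolding ArGeom_list CentGeom_list SomGeom_list by code_simp+

lemma evenperm_comp_on:
  "finite A \<Longrightarrow> p permutes A \<Longrightarrow> q permutes A \<Longrightarrow> evenperm (p \<circ> q) \<longleftrightarrow> evenperm p = evenperm q"
  using evenperm_comp permutation_permutes by blast

text \<open>An inner slice contains one four-cycle of edges, two of centres, and no corner. It corrects
  the parity of the edges without disturbing that of the centres.\<close>

lemma inner_slice:
  obtains m p q where "m \<in> legal" "corner_part m = corner_part \<one>\<^bsub>T_geom\<^esub>"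
    "p permutes ArGeom" "edge_perm m = restrict p ArGeom" "\<not> evenperm p"
    "q permutes CentGeom" "centre_part m = restrict q CentGeom" "evenperm q"
proof
  let ?m = "slice_move E1 1"
  let ?p = "cyc4 (1, 3, 3) (1, -3, 3) (1, -3, -3) (1, 3, -3) :: vec \<Rightarrow> vec"
  let ?q1 = "cyc4 (1, 3, 1) (1, -1, 3) (1, -3, -1) (1, 1, -3) :: vec \<Rightarrow> vec"
  let ?q2 = "cyc4 (1, 3, -1) (1, 1, 3) (1, -3, 1) (1, -1, -3) :: vec \<Rightarrow> vec"
  show "?m \<in> legal" by (simp add: slice_move_legal slices_iff)
  have "restrict (slice_facet E1 1) (set corner_facets) = restrict (\<lambda>x. x) (set corner_facets)"
    using inner_slice_eval(3) by (intro restrict_ext) (simp add: list_all_iff)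
  then show "corner_part ?m = corner_part \<one>\<^bsub>T_geom\<^esub>"
    using restrict_acts_as[OF inner_slice_eval(2)]
    by (simp add: slice_parts one_parts corner_one_def SomGeom_list[symmetric] SomFacets_list[symmetric] id_def)
  show "edge_perm ?m = restrict ?p ArGeom"
    using restrict_acts_as[OF inner_slice_eval(1)] by (simp add: slice_parts ArGeom_list[symmetric])
  show "centre_part ?m = restrict (?q1 \<circ> ?q2) CentGeom"
    using restrict_acts_as[OF inner_slice_eval(4)] unfolding slice_parts CentGeom_list[symmetric] .
  show "?p permutes ArGeom" using cyc4_pieces(1) by (rule cyc4_permutes)
  show "?q1 \<circ> ?q2 permutes CentGeom"
    using cyc4_permutes[OF cyc4_pieces(2)] cyc4_permutes[OF cyc4_pieces(3)] by (rule permutes_compose[rotated])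
  show "\<not> evenperm ?p" by (rule cyc4_odd(2)) simp
  show "evenperm (?q1 \<circ> ?q2)"
    by (subst evenperm_comp) (simp_all add: cyc4_odd)
qed

text \<open>The constraint prescribes the image of one facet of each edge, and equivariance that of the
  other.\<close>

lemma T_geom'_eqI:
  assumes t: "t \<in> T_geom'" and u: "u \<in> T_geom'"
    and eq: "edge_perm t = edge_perm u" "corner_part t = corner_part u" "centre_part t = centre_part u"
  shows "t = u"
proof -
  obtain f F s h where tf: "t = ((f, F), s, h)" by (metis prod.exhaust)
  obtain g G s' h' where ug: "u = ((g, G), s', h')" by (metis prod.exhaust)
  have tu: "(f, F) \<in> bundle_iso edge_geom edge_geom" "(g, G) \<in> bundle_iso edge_geom edge_geom"
    using t u T_geom'_subset by (auto simp: tf ug carrier_T_geom)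
  note F = bundle_isoD[OF tu(1)] and G = bundle_isoD[OF tu(2)]
  have fg: "f = g" using eq(1) by (simp add: edge_perm_def tf ug)
  have sec: "F (edge_section c) = edge_section (f c)" "G (edge_section c) = edge_section (g c)"
    if "c \<in> ArGeom" for c
    using that t u by (auto simp: T_geom'_def tf ug)
  have "F x = G x" if x: "x \<in> geom_facets ArGeom" for x
  proof -
    have c: "fst x \<in> ArGeom" using x by (auto simp: geom_facets_def)
    then show ?thesis
      using edge_facet_cases[OF x] sec[OF c] F(7)[of "edge_section (fst x)"] G(7)[of "edge_section (fst x)"]
        section_facet[OF c] fg by (metis edge_geom_simps(2,4))
  qed
  then have "F = G" using F(3) G(3) by (intro extensionalityI[of _ "geom_facets ArGeom"]) auto
  then show ?thesis using eq fg by (simp add: tf ug corner_part_def centre_part_def)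
qed

lemma even_even_legal:
  assumes t: "t \<in> T_geom'" "corner_part t = corner_part \<one>\<^bsub>T_geom\<^esub>"
    and p: "p permutes ArGeom" "edge_perm t = restrict p ArGeom" "evenperm p"
    and q: "q permutes CentGeom" "centre_part t = restrict q CentGeom" "evenperm q"
  shows "t \<in> legal"
proof -
  obtain a where a: "a \<in> pure_edge_moves" "edge_perm a = restrict p ArGeom"
    using edge.even_permutations p by blast
  obtain b where b: "b \<in> pure_centre_moves" "centre_part b = restrict q CentGeom"
    using centre.even_permutations q by blast
  have ab: "a \<in> legal" "b \<in> legal" using a b by (auto simp: pure_edge_moves_def pure_centre_moves_def)
  then have c: "a \<in> carrier T_geom" "b \<in> carrier T_geom" using legal_carrier by auto
  have abl: "a \<otimes>\<^bsub>T_geom\<^esub> b \<in> legal" using legal_mult ab by blast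
  have "edge_perm (a \<otimes>\<^bsub>T_geom\<^esub> b) = edge_perm (a \<otimes>\<^bsub>T_geom\<^esub> \<one>\<^bsub>T_geom\<^esub>)"
    using b c by (simp only: mult_parts T.one_closed pure_centre_moves_def mem_Collect_eq)
  moreover have "centre_part (a \<otimes>\<^bsub>T_geom\<^esub> b) = centre_part (\<one>\<^bsub>T_geom\<^esub> \<otimes>\<^bsub>T_geom\<^esub> b)"
    using a c by (simp only: mult_parts T.one_closed pure_edge_moves_def mem_Collect_eq)
  moreover have "corner_part (a \<otimes>\<^bsub>T_geom\<^esub> b) = corner_part (\<one>\<^bsub>T_geom\<^esub> \<otimes>\<^bsub>T_geom\<^esub> \<one>\<^bsub>T_geom\<^esub>)"
    using a b c by (simp only: mult_parts T.one_closed pure_edge_moves_def pure_centre_moves_def mem_Collect_eq)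
  ultimately have "a \<otimes>\<^bsub>T_geom\<^esub> b = t"
    using abl legal_subset_T_geom' t p q a b c by (intro T_geom'_eqI) auto
  then show ?thesis using abl by simp
qed

lemma restrict_permutes_comp:
  "q permutes A \<Longrightarrow> compose A (restrict p A) (restrict q A) = restrict (p \<circ> q) A"
  by (rule compose_restrict) (simp add: permutes_in_image)

text \<open>The parity of the edges is corrected by an inner slice.\<close>

theorem even_centres_legal:
  assumes t: "t \<in> T_geom'" "corner_part t = corner_part \<one>\<^bsub>T_geom\<^esub>"
    and q: "q permutes CentGeom" "centre_part t = restrict q CentGeom" "evenperm q"
  shows "t \<in> legal"
proof -
  have tc: "t \<in> carrier T_geom" using t T_geom'_subset by blast
  obtain p where p: "p permutes ArGeom" "edge_perm t = restrict p ArGeom"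
    using Bij_permutes parts_carrier(1)[OF tc] by blast
  show ?thesis
  proof (cases "evenperm p")
    case True
    then show ?thesis using even_even_legal t p q by blast
  next
    case False
    obtain m r s where m: "m \<in> legal" "corner_part m = corner_part \<one>\<^bsub>T_geom\<^esub>"
      and r: "r permutes ArGeom" "edge_perm m = restrict r ArGeom" "\<not> evenperm r"
      and s: "s permutes CentGeom" "centre_part m = restrict s CentGeom" "evenperm s"
      by (rule inner_slice)
    have mc: "m \<in> carrier T_geom" using m legal_carrier by blast
    have "m \<otimes>\<^bsub>T_geom\<^esub> t \<in> legal"
    proof (rule even_even_legal)
      show "m \<otimes>\<^bsub>T_geom\<^esub> t \<in> T_geom'"
        using subgroup.m_closed[OF subgroup_T_geom'] m(1) t(1) legal_subset_T_geom' by blast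
      show "corner_part (m \<otimes>\<^bsub>T_geom\<^esub> t) = corner_part \<one>\<^bsub>T_geom\<^esub>"
        using corner_kernel_mult[OF mc tc] m t by blast
      show "r \<circ> p permutes ArGeom" "s \<circ> q permutes CentGeom"
        using permutes_compose p q r s by blast+
      show "edge_perm (m \<otimes>\<^bsub>T_geom\<^esub> t) = restrict (r \<circ> p) ArGeom"
        "centre_part (m \<otimes>\<^bsub>T_geom\<^esub> t) = restrict (s \<circ> q) CentGeom"
        using mc tc p q r s by (simp_all only: mult_parts restrict_permutes_comp)
      show "evenperm (r \<circ> p)" "evenperm (s \<circ> q)"
        using evenperm_comp_on[OF _ r(1) p(1)] evenperm_comp_on[OF _ s(1) q(1)] False q r s by simp_all
    qed
    then have "inv\<^bsub>T_geom\<^esub> m \<otimes>\<^bsub>T_geom\<^esub> (m \<otimes>\<^bsub>T_geom\<^esub> t) \<in> legal"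
      using legal_mult legal_inv m by blast
    then show ?thesis using mc tc by (simp add: T.m_assoc[symmetric])
  qed
qed

text \<open>A face turn is odd on the corners and supplies the permutations missed by three-cycles.\<close>

theorem all_corner_permutations:
  assumes "p permutes SomGeom"
  obtains l where "l \<in> legal" "fst (corner_part l) = restrict p SomGeom"
proof (cases "evenperm p")
  case True
  then show ?thesis using corner.even_permutations assms that by blast
next
  case False
  let ?m = "slice_move E1 3"
  let ?r = "cyc4 (3, 3, 3) (3, -3, 3) (3, -3, -3) (3, 3, -3) :: vec \<Rightarrow> vec"
  have m: "?m \<in> legal" by (simp add: slice_move_legal slices_iff)
  then have mc: "?m \<in> carrier T_geom" by (rule legal_carrier)
  have r: "?r permutes SomGeom" using cyc4_pieces(4) by (rule cyc4_permutes)
  have mr: "fst (corner_part ?m) = restrict ?r SomGeom"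
    using restrict_acts_as[OF face_eval] by (simp add: slice_parts SomGeom_list[symmetric])
  have r': "inv_into UNIV ?r permutes SomGeom" "?r \<circ> (inv_into UNIV ?r \<circ> p) = p"
    using r permutes_inv permutes_inv_o(1)[OF r] by (auto simp: comp_assoc[symmetric] simp del: comp_assoc)
  have odd: "\<not> evenperm ?r" by (rule cyc4_odd(2)) simp
  have "evenperm (inv_into UNIV ?r \<circ> p)"
    using evenperm_comp_on[OF _ r permutes_compose[OF assms r'(1)]] r'(2) False odd by simp
  then obtain l where l: "l \<in> legal" "fst (corner_part l) = restrict (inv_into UNIV ?r \<circ> p) SomGeom"
    using corner.even_permutations permutes_compose[OF assms r'(1)] by blast
  have "fst (corner_part (?m \<otimes>\<^bsub>T_geom\<^esub> l)) = restrict (?r \<circ> (inv_into UNIV ?r \<circ> p)) SomGeom"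
    using mult_parts(3)[OF mc legal_carrier[OF l(1)]]
    unfolding mr l(2) restrict_permutes_comp[OF permutes_compose[OF assms r'(1)]] .
  then show ?thesis using that[OF legal_mult[OF m l(1)]] unfolding r'(2) by blast
qed

section \<open>Corner twists\<close>

definition turn :: "gfacet \<Rightarrow> gfacet" where
  "turn = (\<lambda>(c, n). (c, corner_turn c n))"

text \<open>The reference facet of a corner is the horizontal one, with normal along the third axis.\<close>

fun ref :: "vec \<Rightarrow> gfacet" where
  "ref (x, y, z) = ((x, y, z), (0, 0, z div 3))"

text \<open>The number of turns leading from the reference facet of its corner to the given facet.\<close>

definition ori :: "gfacet \<Rightarrow> nat" where
  "ori x = (if x = ref (fst x) then 0 else if x = turn (ref (fst x)) then 1 else 2)"

definition ori_law :: "gfacet \<Rightarrow> bool" where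
  "ori_law x \<longleftrightarrow> x = (turn ^^ ori x) (ref (fst x)) \<and> ori (turn x) = (ori x + 1) mod 3"

definition ref_law :: "vec \<Rightarrow> bool" where
  "ref_law c \<longleftrightarrow> snd (ref c) \<in> set normal_list \<and> dot c (snd (ref c)) = 3"

lemma ori_eval: "list_all ori_law corner_facets" "list_all ref_law corners"
  by code_simp+

abbreviation "CF \<equiv> geom_facets SomGeom"

lemma fst_ref [simp]: "fst (ref c) = c"
  by (cases c) simp

lemma ref_facet: "c \<in> SomGeom \<Longrightarrow> ref c \<in> CF"
  using ori_eval(2) geom_facets_iff[of c "snd (ref c)" SomGeom]
  by (simp add: list_all_iff ref_law_def SomGeom_list[symmetric] prod.collapse[of "ref c", unfolded fst_ref])

lemma facet_corner: "x \<in> CF \<Longrightarrow> fst x \<in> SomGeom"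
  by (auto simp: geom_facets_def)

lemma ori_facet: "x \<in> CF \<Longrightarrow> (turn ^^ ori x) (ref (fst x)) = x"
  and ori_turn: "x \<in> CF \<Longrightarrow> ori (turn x) = (ori x + 1) mod 3"
  using ori_eval(1) by (auto simp: list_all_iff ori_law_def SomFacets_list)

lemma ori_less: "ori x < 3"
  by (simp add: ori_def)

lemma ori_ref [simp]: "ori (ref c) = 0"
  by (simp add: ori_def)

lemma gen_corner_geom: "gen corner_geom = turn"
  by (simp add: turn_def)

lemma turn_pow_facet: "x \<in> CF \<Longrightarrow> (turn ^^ m) x \<in> CF"
  using bundle_closed_funpow[OF bundle_closed_corner_geom, of x m] by (simp add: gen_corner_geom del: corner_geom_simps(4))

lemma fst_turn_pow [simp]: "fst ((turn ^^ m) x) = fst x"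
  by (induction m) (simp_all add: turn_def split_beta)

lemma turn_pow_three: "x \<in> CF \<Longrightarrow> (turn ^^ 3) x = x"
  using turn_facet_cube by (simp add: numeral_3_eq_3 turn_def)

lemma turn_pow_cong: "x \<in> CF \<Longrightarrow> m mod 3 = n mod 3 \<Longrightarrow> (turn ^^ m) x = (turn ^^ n) x"
proof -
  assume x: "x \<in> CF" and mn: "m mod 3 = n mod 3"
  have three: "((turn ^^ 3) ^^ q) y = y" if "y \<in> CF" for q y
    using that by (induction q) (simp_all add: turn_pow_three)
  have "(turn ^^ k) x = (turn ^^ (k mod 3)) x" for k
  proof -
    have "(turn ^^ k) x = (turn ^^ (3 * (k div 3) + k mod 3)) x" by simp
    also have "\<dots> = ((turn ^^ 3) ^^ (k div 3)) ((turn ^^ (k mod 3)) x)"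
      by (simp only: funpow_add funpow_mult o_apply)
    finally show ?thesis using three turn_pow_facet[OF x] by simp
  qed
  then show ?thesis using mn by metis
qed

lemma ori_turn_pow: "x \<in> CF \<Longrightarrow> ori ((turn ^^ m) x) = (ori x + m) mod 3"
proof (induction m)
  case 0
  then show ?case by (simp add: ori_less)
next
  case (Suc m)
  then show ?case using ori_turn[OF turn_pow_facet[OF Suc.prems, of m]] by (simp add: mod_simps)
qed

abbreviation "corner_aut \<equiv> bundle_iso corner_geom corner_geom"

lemma corner_autD:
  assumes "s \<in> corner_aut"
  shows "bij_betw (fst s) SomGeom SomGeom" "c \<in> SomGeom \<Longrightarrow> fst s c \<in> SomGeom"
    "x \<in> CF \<Longrightarrow> snd s x \<in> CF" "x \<in> CF \<Longrightarrow> fst (snd s x) = fst s (fst x)"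
    "x \<in> CF \<Longrightarrow> snd s ((turn ^^ m) x) = (turn ^^ m) (snd s x)"
    "fst s \<in> extensional SomGeom" "snd s \<in> extensional CF"
proof -
  obtain f F where s: "s = (f, F)" by fastforce
  note D = bundle_isoD[OF assms[unfolded s]]
  show "bij_betw (fst s) SomGeom SomGeom" "c \<in> SomGeom \<Longrightarrow> fst s c \<in> SomGeom"
    "x \<in> CF \<Longrightarrow> snd s x \<in> CF" "x \<in> CF \<Longrightarrow> fst (snd s x) = fst s (fst x)"
    "fst s \<in> extensional SomGeom" "snd s \<in> extensional CF"
    using D by (simp_all add: s)
  show "x \<in> CF \<Longrightarrow> snd s ((turn ^^ m) x) = (turn ^^ m) (snd s x)"
    using D(6)[of x m] unfolding gen_corner_geom by (simp add: s)
qed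

definition corner_ori :: "(vec, gfacet, vec, gfacet) bundle_map \<Rightarrow> vec \<Rightarrow> nat" where
  "corner_ori s c = ori (snd s (ref c))"

definition twist :: "(vec, gfacet, vec, gfacet) bundle_map \<Rightarrow> nat" where
  "twist s = (\<Sum>c\<in>SomGeom. corner_ori s c) mod 3"

lemma corner_aut_facet:
  assumes s: "s \<in> corner_aut" and x: "x \<in> CF"
  shows "snd s x = (turn ^^ (ori x + corner_ori s (fst x))) (ref (fst s (fst x)))"
proof -
  let ?r = "ref (fst x)"
  have r: "?r \<in> CF" "fst x \<in> SomGeom" using x facet_corner ref_facet by auto
  note D = corner_autD[OF s]
  have "snd s x = snd s ((turn ^^ ori x) ?r)" using ori_facet[OF x] by simp
  also have "\<dots> = (turn ^^ ori x) (snd s ?r)" using D(5)[OF r(1)] .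
  also have "snd s ?r = (turn ^^ corner_ori s (fst x)) (ref (fst s (fst x)))"
    using ori_facet[OF D(3)[OF r(1)]] D(4)[OF r(1)] by (simp add: corner_ori_def)
  finally show ?thesis by (simp only: funpow_add o_apply)
qed

text \<open>The turn of a corner under a product is the sum of its turns under both factors, the
  second measured at the corner to which it has been carried; summing over all corners removes that
  displacement.\<close>

lemma twist_comp:
  assumes s: "s \<in> corner_aut" and t: "t \<in> corner_aut"
  shows "twist (bundle_comp corner_geom s t) = (twist s + twist t) mod 3"
proof -
  note D = corner_autD[OF t]
  have "corner_ori (bundle_comp corner_geom s t) c mod 3
    = (corner_ori s (fst t c) + corner_ori t c) mod 3" if c: "c \<in> SomGeom" for c
  proof -
    have r: "ref c \<in> CF" using ref_facet c .
    have "snd s (snd t (ref c)) = (turn ^^ (corner_ori t c + corner_ori s (fst t c))) (ref (fst s (fst t c)))"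
      using corner_aut_facet[OF s D(3)[OF r]] D(4)[OF r] by (simp add: corner_ori_def)
    moreover have "corner_ori (bundle_comp corner_geom s t) c = ori (snd s (snd t (ref c)))"
      using r by (simp add: corner_ori_def bundle_comp_def compose_eq)
    ultimately show ?thesis
      using ori_turn_pow ref_facet[OF corner_autD(2)[OF s D(2)[OF c]]] by (simp add: add.commute)
  qed
  then have "twist (bundle_comp corner_geom s t)
      = (\<Sum>c\<in>SomGeom. corner_ori s (fst t c) + corner_ori t c) mod 3"
    unfolding twist_def by (subst (1 2) mod_sum_eq[symmetric]) (simp cong: sum.cong)
  also have "\<dots> = ((\<Sum>c\<in>SomGeom. corner_ori s c) + (\<Sum>c\<in>SomGeom. corner_ori t c)) mod 3"
    using sum.reindex_bij_betw[OF D(1), of "corner_ori s"] by (simp add: sum.distrib)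
  finally show ?thesis by (simp add: twist_def mod_simps)
qed

definition corner_twist :: "(vec \<Rightarrow> nat) \<Rightarrow> (vec, gfacet, vec, gfacet) bundle_map" where
  "corner_twist k = (\<lambda>c\<in>SomGeom. c, \<lambda>x\<in>CF. (turn ^^ k (fst x)) x)"

lemma corner_twist_cong:
  "(\<And>c. c \<in> SomGeom \<Longrightarrow> k c mod 3 = j c mod 3) \<Longrightarrow> corner_twist k = corner_twist j"
  unfolding corner_twist_def
  by (intro arg_cong2[where f = Pair] refl restrict_ext turn_pow_cong) (simp_all add: facet_corner)

lemma corner_twist_comp:
  "bundle_comp corner_geom (corner_twist k) (corner_twist j) = corner_twist (\<lambda>c. k c + j c)"
  by (auto simp: bundle_comp_def corner_twist_def compose_def fun_eq_iff funpow_add turn_pow_facet)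

lemma corner_twist_zero: "corner_twist (\<lambda>c. 0) = corner_one"
  by (simp add: corner_twist_def corner_one_def)

lemma corner_twist_aut: "corner_twist k \<in> corner_aut"
proof -
  have inv: "bundle_comp corner_geom (corner_twist (\<lambda>c. 2 * k c)) (corner_twist k) = corner_one"
    "bundle_comp corner_geom (corner_twist k) (corner_twist (\<lambda>c. 2 * k c)) = corner_one"
    unfolding corner_twist_comp corner_twist_zero[symmetric] by (rule corner_twist_cong; simp)+
  let ?F = "\<lambda>k :: vec \<Rightarrow> nat. \<lambda>x\<in>CF. (turn ^^ k (fst x)) x"
  have "compose CF (?F (\<lambda>c. 2 * k c)) (?F k) = (\<lambda>x\<in>CF. x)" "compose CF (?F k) (?F (\<lambda>c. 2 * k c)) = (\<lambda>x\<in>CF. x)"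
    using inv by (simp_all add: bundle_comp_def corner_twist_def corner_one_def)
  then have "?F (\<lambda>c. 2 * k c) (?F k x) = x" "?F k (?F (\<lambda>c. 2 * k c) x) = x" if "x \<in> CF" for x
    using that by (metis (no_types, lifting) compose_eq restrict_apply')+
  then have "bij_betw (?F k) CF CF"
    by (intro bij_betw_byWitness[where f' = "?F (\<lambda>c. 2 * k c)"]) (auto simp: turn_pow_facet)
  moreover have "turn x \<in> CF" if "x \<in> CF" for x using turn_pow_facet[OF that, of 1] by simp
  ultimately show ?thesis
    unfolding corner_twist_def
    by (intro bundle_isoI bundle_closed_corner_geom)
      (auto simp: bij_betw_id[unfolded id_def] gen_corner_geom facet_corner funpow_swap1 fst_turn_pow[of 1, simplified] simp del: corner_geom_simps(4))
qed

lemma twist_corner_twist: "twist (corner_twist k) = (\<Sum>c\<in>SomGeom. k c) mod 3"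
proof -
  have "corner_ori (corner_twist k) c = k c mod 3" if "c \<in> SomGeom" for c
    using ref_facet[OF that] ori_turn_pow by (simp add: corner_ori_def corner_twist_def)
  then show ?thesis by (simp add: twist_def mod_sum_eq cong: sum.cong)
qed

text \<open>By equivariance an automorphism is known from the images of the reference facets.\<close>

lemma fixing_corners_is_twist:
  assumes s: "s \<in> corner_aut" and fixes_: "fst s = (\<lambda>c\<in>SomGeom. c)"
  shows "s = corner_twist (corner_ori s)"
proof (rule prod_eqI)
  show "fst s = fst (corner_twist (corner_ori s))" by (simp add: fixes_ corner_twist_def)
  have "snd s x = (turn ^^ corner_ori s (fst x)) x" if x: "x \<in> CF" for x
  proof -
    have "snd s x = (turn ^^ (corner_ori s (fst x) + ori x)) (ref (fst x))"
      using corner_aut_facet[OF s x] facet_corner[OF x] by (simp add: fixes_ add.commute)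
    also have "\<dots> = (turn ^^ corner_ori s (fst x)) ((turn ^^ ori x) (ref (fst x)))"
      by (simp only: funpow_add o_apply)
    finally show ?thesis using ori_facet[OF x] by simp
  qed
  then show "snd s = snd (corner_twist (corner_ori s))"
    using corner_autD(7)[OF s] unfolding corner_twist_def
    by (intro extensionalityI[of _ CF]) auto
qed

definition slice_ori :: "axis \<times> int \<Rightarrow> nat" where
  "slice_ori = (\<lambda>(i, v). sum_list (map (\<lambda>c. ori (slice_facet i v (ref c))) corners) mod 3)"

lemma slice_ori_eval: "list_all (\<lambda>m. slice_ori m = 0) slices"
  by code_simp

lemma distinct_corners: "distinct corners"
  by code_simp

lemma twist_slice:
  assumes "(i, v) \<in> set slices" shows "twist (corner_part (slice_move i v)) = 0"
proof -
  have "twist (corner_part (slice_move i v)) = (\<Sum>c\<in>SomGeom. ori (slice_facet i v (ref c))) mod 3"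
    by (simp add: twist_def corner_ori_def slice_parts ref_facet cong: sum.cong)
  also have "\<dots> = slice_ori (i, v)"
    unfolding SomGeom_list by (simp add: slice_ori_def sum.distinct_set_conv_list[OF distinct_corners])
  finally show ?thesis using slice_ori_eval assms by (simp add: list_all_iff)
qed

lemma twist_mult:
  assumes "t \<in> carrier T_geom" "u \<in> carrier T_geom"
  shows "twist (corner_part (t \<otimes>\<^bsub>T_geom\<^esub> u)) = (twist (corner_part t) + twist (corner_part u)) mod 3"
  using twist_comp parts_carrier(2) assms by (simp add: mult_parts)

lemma twist_one: "twist corner_one = 0"
  using twist_corner_twist[of "\<lambda>c. 0"] by (simp add: corner_twist_zero)

lemma twist_less: "twist s < 3"
  by (simp add: twist_def)

lemma twist_inv:
  assumes "t \<in> carrier T_geom"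
  shows "(twist (corner_part (inv\<^bsub>T_geom\<^esub> t)) + twist (corner_part t)) mod 3 = 0"
  using twist_mult[OF T.inv_closed[OF assms] assms] assms by (simp add: one_parts twist_one)

text \<open>Elements of zero twist form a subgroup, so the twelve slice moves decide.\<close>

theorem twist_legal:
  assumes "l \<in> legal" shows "twist (corner_part l) = 0"
proof -
  let ?K = "{t \<in> carrier T_geom. twist (corner_part t) = 0}"
  have sub: "subgroup ?K T_geom"
  proof (rule T.subgroupI)
    show "?K \<noteq> {}" using T.one_closed twist_one one_parts(2) by force
    show "inv\<^bsub>T_geom\<^esub> t \<in> ?K" if "t \<in> ?K" for t
      using that twist_inv[of t] twist_less[of "corner_part (inv\<^bsub>T_geom\<^esub> t)"] by auto
  qed (auto simp: twist_mult)
  have K: "slice_move i v \<in> ?K" if "v \<in> {- 3, - 1, 1, 3}" for i v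
    using twist_slice[of i v] slice_move_legal[of i v] legal_carrier slices_iff[of i v] that by simp
  have "{slice_move i v |i v. v \<in> {- 3, - 1, 1, 3}} \<subseteq> ?K"
    by (intro subsetI, elim CollectE exE conjE, hypsubst, rule K)
  then have "legal \<subseteq> ?K"
    unfolding legal_def by (rule T.generate_subgroup_incl[OF _ sub])
  then show ?thesis using assms by blast
qed

text \<open>The twists available as corner parts of legal moves, with no control over edges and centres.\<close>

definition legal_twist :: "(vec \<Rightarrow> nat) \<Rightarrow> bool" where
  "legal_twist k \<longleftrightarrow> (\<exists>l\<in>legal. corner_part l = corner_twist k)"

lemma legal_twist_add: "legal_twist k \<Longrightarrow> legal_twist j \<Longrightarrow> legal_twist (\<lambda>c. k c + j c)"
proof -
  assume "legal_twist k" "legal_twist j"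
  then obtain l m where l: "l \<in> legal" "corner_part l = corner_twist k"
    and m: "m \<in> legal" "corner_part m = corner_twist j" by (auto simp: legal_twist_def)
  have "corner_part (l \<otimes>\<^bsub>T_geom\<^esub> m) = corner_twist (\<lambda>c. k c + j c)"
    using l m by (simp add: mult_parts legal_carrier corner_twist_comp)
  then show ?thesis using legal_mult[OF l(1) m(1)] unfolding legal_twist_def by blast
qed

lemma legal_twist_cong:
  "legal_twist k \<Longrightarrow> (\<And>c. c \<in> SomGeom \<Longrightarrow> k c mod 3 = j c mod 3) \<Longrightarrow> legal_twist j"
  using corner_twist_cong[of k j] by (simp add: legal_twist_def)

lemma legal_twist_zero: "legal_twist (\<lambda>c. 0)"
  unfolding legal_twist_def using one_legal one_parts(2) corner_twist_zero by auto

text \<open>Conjugating by a legal move that permutes the corners by \<open>p\<close> transports the twists along \<open>p\<close>.\<close>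

lemma legal_twist_conj:
  assumes k: "legal_twist k" and p: "p permutes SomGeom" and j: "\<And>c. c \<in> SomGeom \<Longrightarrow> j (p c) = k c"
  shows "legal_twist j"
proof -
  obtain t where t: "t \<in> legal" "corner_part t = corner_twist k" using k by (auto simp: legal_twist_def)
  obtain l where l: "l \<in> legal" "fst (corner_part l) = restrict p SomGeom" using all_corner_permutations[OF p] .
  note c = legal_carrier[OF t(1)] legal_carrier[OF l(1)]
  let ?s = "corner_part l"
  have s: "?s \<in> corner_aut" using parts_carrier(2) c by blast
  have comm: "bundle_comp corner_geom ?s (corner_twist k) = bundle_comp corner_geom (corner_twist j) ?s"
  proof (rule prod_eqI)
    show "fst (bundle_comp corner_geom ?s (corner_twist k)) = fst (bundle_comp corner_geom (corner_twist j) ?s)"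
      using corner_autD(2)[OF s] by (auto simp: bundle_comp_def corner_twist_def compose_def)
    show "snd (bundle_comp corner_geom ?s (corner_twist k)) = snd (bundle_comp corner_geom (corner_twist j) ?s)"
    proof (rule ext)
      fix x
      show "snd (bundle_comp corner_geom ?s (corner_twist k)) x = snd (bundle_comp corner_geom (corner_twist j) ?s) x"
      proof (cases "x \<in> CF")
        case True
        then have "fst (snd ?s x) = p (fst x)"
          using corner_autD(4)[OF s] facet_corner by (simp add: l(2))
        then show ?thesis
          using True corner_autD(3,5)[OF s] j facet_corner[OF True]
          by (simp add: bundle_comp_def corner_twist_def compose_eq)
      qed (simp add: bundle_comp_def compose_def)
    qed
  qed
  let ?l' = "inv\<^bsub>T_geom\<^esub> l"
  have l': "?l' \<in> carrier T_geom" using c by simp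
  have s': "corner_part ?l' \<in> corner_aut" using parts_carrier(2) l' by blast
  have "corner_part (l \<otimes>\<^bsub>T_geom\<^esub> t \<otimes>\<^bsub>T_geom\<^esub> ?l')
    = bundle_comp corner_geom (bundle_comp corner_geom (corner_twist j) ?s) (corner_part ?l')"
    using c l' by (simp add: mult_parts t comm)
  also have "\<dots> = bundle_comp corner_geom (corner_twist j) (bundle_comp corner_geom ?s (corner_part ?l'))"
    by (rule bundle_comp_assoc[OF s', symmetric])
  also have "bundle_comp corner_geom ?s (corner_part ?l') = corner_one"
    using mult_parts(2)[OF c(2) l'] c by (simp add: one_parts)
  also have "bundle_comp corner_geom (corner_twist j) corner_one = corner_twist j"
    using corner_twist_comp[of j "\<lambda>c. 0"] by (simp add: corner_twist_zero)
  finally show ?thesis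
    using legal_mult[OF legal_mult[OF l(1) t(1)] legal_inv[OF l(1)]] unfolding legal_twist_def by blast
qed

text \<open>The commutator of two face turns, squared, acts on the corners by twists only; the commutator of
  this with the turn of a third face, which contains exactly one of the corners so twisted,
  leaves two corners turned in opposite directions.\<close>

definition twist_word where
  "twist_word = (let w = commutator_word [(E1, -3)] [(E2, -3)] in commutator_word (w @ w) [(E1, 3)])"

definition twist_seed :: "vec \<Rightarrow> nat" where
  "twist_seed c = (if c = (3, -3, -3) then 1 else if c = (3, -3, 3) then 2 else 0)"

definition twists_facet :: "(axis \<times> int) list \<Rightarrow> (vec \<Rightarrow> nat) \<Rightarrow> gfacet \<Rightarrow> bool" where
  "twists_facet w k x \<longleftrightarrow> facet_word w x = (turn ^^ k (fst x)) x"

lemma twist_word_eval: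
  "set twist_word \<subseteq> set slices"
  "list_all (acts_on_cubie twist_word id) corners"
  "list_all (twists_facet twist_word twist_seed) corner_facets"
  by code_simp+

lemma legal_twist_seed: "legal_twist twist_seed"
proof -
  have "restrict (facet_word twist_word) (set corner_facets)
    = restrict (\<lambda>x. (turn ^^ twist_seed (fst x)) x) (set corner_facets)"
    using twist_word_eval(3) by (intro restrict_ext) (simp add: list_all_iff twists_facet_def)
  then have "corner_part (word_move twist_word) = corner_twist twist_seed"
    using restrict_cubie_word[OF twist_word_eval(2)]
    by (simp add: word_parts corner_twist_def SomGeom_list[symmetric] SomFacets_list[symmetric] id_def)
  then show ?thesis using word_move_symmetry_legal[OF twist_word_eval(1)] unfolding legal_twist_def by blast
qed

text \<open>All ordered pairs of corners are equivalent to that of the seed, as legal moves permute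
  the corners arbitrarily.\<close>

lemma legal_twist_pair:
  assumes "a \<in> SomGeom" "b \<in> SomGeom" "a \<noteq> b"
  shows "legal_twist (\<lambda>c. if c = a then 1 else if c = b then 2 else 0)"
proof -
  let ?a = "(3, -3, -3) :: vec" and ?b = "(3, -3, 3) :: vec"
  let ?b' = "transpose ?a a ?b"
  let ?p = "transpose ?b' b \<circ> transpose ?a a"
  have mem: "?a \<in> SomGeom" "?b \<in> SomGeom" unfolding SomGeom_list by code_simp+
  then have b': "?b' \<in> SomGeom" "?b' \<noteq> a" using assms by (auto simp: transpose_def)
  have p: "?p permutes SomGeom" using mem b' assms by (intro permutes_compose permutes_swap_id)
  have ab: "?p ?a = a" "?p ?b = b" using b' assms(3) by (simp_all add: transpose_def)
  have inj: "?p c = ?p d \<longleftrightarrow> c = d" for c d using permutes_inj[OF p] by (simp add: inj_eq del: o_apply)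
  show ?thesis
  proof (rule legal_twist_conj[OF legal_twist_seed p])
    show "(if ?p c = a then 1 else if ?p c = b then 2 else 0) = twist_seed c" for c
      using inj[of c ?a] inj[of c ?b] unfolding ab by (simp add: twist_seed_def del: o_apply)
  qed
qed

text \<open>Each corner is untwisted at the expense of the fixed corner \<open>(3, 3, 3)\<close>, whose own twist then
  vanishes because the sum does.\<close>

theorem legal_twist_sum_zero:
  assumes "(\<Sum>c\<in>SomGeom. k c) mod 3 = 0"
  shows "legal_twist k"
proof -
  let ?b = "(3, 3, 3) :: vec"
  have b: "?b \<in> SomGeom" by (rule seed_pieces)
  have single: "legal_twist (\<lambda>c. if c = a then m else if c = ?b then 2 * m else 0)"
    if "a \<in> SomGeom - {?b}" for a m
  proof (induction m)
    case 0
    show ?case by (rule legal_twist_cong[OF legal_twist_zero]) auto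
  next
    case (Suc m)
    show ?case
      by (rule legal_twist_cong[OF legal_twist_add[OF Suc legal_twist_pair[of a ?b]]]) (use that b in auto)
  qed
  have "legal_twist (\<lambda>c. if c \<in> S then k c else if c = ?b then 2 * sum k S else 0)"
    if "finite S" "S \<subseteq> SomGeom - {?b}" for S
    using that
  proof (induction S rule: finite_induct)
    case empty
    show ?case by (rule legal_twist_cong[OF legal_twist_zero]) auto
  next
    case (insert a S)
    have "legal_twist (\<lambda>c. if c \<in> S then k c else if c = ?b then 2 * sum k S else 0)" using insert by simp
    from legal_twist_add[OF this single[of a "k a"]] show ?case
      by (rule legal_twist_cong) (use insert in \<open>auto simp: add.commute\<close>)
  qed
  from this[of "SomGeom - {?b}"] show ?thesis
  proof (rule legal_twist_cong)
    fix c assume c: "c \<in> SomGeom"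
    have "(\<Sum>c\<in>SomGeom. k c) = k ?b + sum k (SomGeom - {?b})" by (rule sum.remove) (use b in simp_all)
    moreover have "2 * n mod 3 = m mod 3" if "(m + n) mod 3 = 0" for m n :: nat
      using that by presburger
    ultimately have "2 * sum k (SomGeom - {?b}) mod 3 = k ?b mod 3" using assms by metis
    then show "(if c \<in> SomGeom - {?b} then k c else if c = ?b then 2 * sum k (SomGeom - {?b}) else 0) mod 3 = k c mod 3"
      using c by simp
  qed simp_all
qed

text \<open>A legal move with the same corner permutation reduces to a pure twist, again of total zero.\<close>

theorem legal_corner_part:
  assumes s: "s \<in> corner_aut" and zero: "twist s = 0"
  obtains l where "l \<in> legal" "corner_part l = s"
proof -
  have "fst s \<in> Bij SomGeom" using corner_autD(1,6)[OF s] by (simp add: Bij_def)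
  then obtain p where p: "p permutes SomGeom" "fst s = restrict p SomGeom" by (rule Bij_permutes)
  obtain m where m: "m \<in> legal" "fst (corner_part m) = fst s" using all_corner_permutations[OF p(1)] p(2) by metis
  let ?r = "corner_part m" and ?r' = "corner_part (inv\<^bsub>T_geom\<^esub> m)"
  note mc = legal_carrier[OF m(1)]
  have r: "?r \<in> corner_aut" "?r' \<in> corner_aut" using parts_carrier(2) mc by auto
  have inv: "bundle_comp corner_geom ?r ?r' = corner_one" "bundle_comp corner_geom ?r' ?r = corner_one"
    using mult_parts(2)[OF mc T.inv_closed[OF mc]] mult_parts(2)[OF T.inv_closed[OF mc] mc] mc
    by (simp_all add: one_parts)
  let ?q = "bundle_comp corner_geom s ?r'"
  have q: "?q \<in> corner_aut" by (rule bundle_comp_iso[OF bundle_closed_corner_geom s r(2)])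
  have "fst ?q = fst (bundle_comp corner_geom ?r ?r')" by (simp add: bundle_comp_def m(2))
  then have "fst ?q = (\<lambda>c\<in>SomGeom. c)" by (simp add: inv corner_one_def)
  then have qk: "?q = corner_twist (corner_ori ?q)" by (rule fixing_corners_is_twist[OF q])
  have "twist ?q = 0"
    using twist_comp[OF s r(2)] twist_legal[OF legal_inv[OF m(1)]] zero by simp
  then have "legal_twist (corner_ori ?q)" by (intro legal_twist_sum_zero) (simp add: twist_def)
  then obtain l where l: "l \<in> legal" "corner_part l = ?q" using qk by (auto simp: legal_twist_def)
  have "corner_part (l \<otimes>\<^bsub>T_geom\<^esub> m) = bundle_comp corner_geom ?q ?r"
    using mult_parts(2)[OF legal_carrier[OF l(1)] mc] l(2) by simp
  also have "\<dots> = bundle_comp corner_geom s corner_one"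
    using bundle_comp_assoc[OF r(1), of s ?r'] inv(2) by simp
  also have "\<dots> = s" using bundle_comp_one(2)[OF s] by (simp add: corner_one_def)
  finally show ?thesis using that legal_mult[OF l(1) m(1)] by blast
qed

section \<open>Double orbits\<close>

lemma bundle_comp_cancel:
  assumes a: "a \<in> bundle_iso A B" and p: "p \<in> bundle_iso A A" and q: "q \<in> bundle_iso A A"
    and eq: "bundle_comp A a p = bundle_comp A a q"
  shows "p = q"
proof -
  have "bundle_comp A (bundle_inv A B a) (bundle_comp A a r) = r" if r: "r \<in> bundle_iso A A" for r
    unfolding bundle_comp_assoc[OF r, of "bundle_inv A B a" a] bundle_comp_inv(1)[OF a] bundle_comp_one(1)[OF r] ..
  from this[OF p] this[OF q] eq show ?thesis by metis
qed

text \<open>The left action of \<open>a t a\<^sup>-\<^sup>1\<close> on \<open>a w\<close> is \<open>a (t w)\<close>. This turns double orbits of states into double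
  cosets of \<open>T_geom'\<close>.\<close>

lemma bundle_conj_comp:
  assumes A: "bundle_closed A" and a: "a \<in> bundle_iso A B" and t: "t \<in> bundle_iso A A" and w: "w \<in> bundle_iso A A"
  shows "bundle_comp A (bundle_comp B (bundle_comp A a t) (bundle_inv A B a)) (bundle_comp A a w)
    = bundle_comp A a (bundle_comp A t w)"
proof -
  let ?at = "bundle_comp A a t"
  have at: "?at \<in> bundle_iso A B" using bundle_comp_iso[OF A a t] .
  have "bundle_comp A (bundle_comp B ?at (bundle_inv A B a)) a = ?at"
    unfolding bundle_comp_assoc[OF a, of ?at "bundle_inv A B a", symmetric] bundle_comp_inv(1)[OF a]
      bundle_comp_one(2)[OF at] ..
  then show ?thesis
    unfolding bundle_comp_assoc[OF w, of "bundle_comp B ?at (bundle_inv A B a)" a] bundle_comp_assoc[OF w, of a t]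
    by (simp only:)
qed

lemma compose_conj:
  assumes h: "bij_betw h A B" and w: "w \<in> Bij A"
  shows "compose A (compose B (compose A h t) (restrict (inv_into A h) B)) (compose A h w)
    = compose A h (compose A t w)"
proof
  fix c
  show "compose A (compose B (compose A h t) (restrict (inv_into A h) B)) (compose A h w) c
    = compose A h (compose A t w) c"
  proof (cases "c \<in> A")
    case True
    then have wc: "w c \<in> A" using w by (auto simp: Bij_def dest: bij_betwE)
    then have "h (w c) \<in> B" "inv_into A h (h (w c)) = w c"
      using h by (auto dest: bij_betwE simp: bij_betw_inv_into_left)
    then show ?thesis using True wc by (simp add: compose_eq)
  qed (simp add: compose_def)
qed

lemma bundle_closed_edge_mat: "bundle_closed edge_mat"
proof -
  have "(THE c'. c' \<in> P \<and> c' \<noteq> c) \<in> P" if P: "(P, j) \<in> ArMat" "c \<in> P" for P j c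
  proof -
    obtain a b where ab: "P = {a, b}" "a \<noteq> b" using P by (auto simp: ArMat_def compatible_def)
    then have "\<exists>!c'. c' \<in> P \<and> c' \<noteq> c" using P(2) by auto
    from theI'[OF this] show ?thesis by blast
  qed
  then show ?thesis by (auto simp: bundle_closed_def edge_mat_def)
qed

lemma T_geom'_carrier: "t \<in> T_geom' \<Longrightarrow> t \<in> carrier T_geom"
  using T_geom'_subset by blast

lemma T_geom'_mult: "t \<in> T_geom' \<Longrightarrow> u \<in> T_geom' \<Longrightarrow> t \<otimes>\<^bsub>T_geom\<^esub> u \<in> T_geom'"
  using subgroup.m_closed[OF subgroup_T_geom'] .

lemma T_geom'_inv: "t \<in> T_geom' \<Longrightarrow> inv\<^bsub>T_geom\<^esub> t \<in> T_geom'"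
  using subgroup.m_inv_closed[OF subgroup_T_geom'] .

lemma edge_trivial_in_T_geom':
  assumes "s \<in> corner_aut" "\<phi> \<in> Bij CentGeom"
  shows "(edge_one, s, \<phi>) \<in> T_geom'"
  using assms bundle_one_iso[OF bundle_closed_edge_geom]
  by (simp add: T_geom'_def carrier_T_geom edge_one_def section_facet split_beta)

lemma corner_one_aut: "corner_one \<in> corner_aut"
  using bundle_one_iso[OF bundle_closed_corner_geom] by (simp add: corner_one_def)

lemma permutes_restrict_eq:
  assumes "p permutes A" "q permutes A" "restrict p A = restrict q A"
  shows "p = q"
proof
  fix x
  show "p x = q x"
    using fun_cong[OF assms(3), of x] permutes_not_in[OF assms(1)] permutes_not_in[OF assms(2)]
    by (cases "x \<in> A") simp_all
qed

lemma T_cancel_inv: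
  "t \<in> carrier T_geom \<Longrightarrow> u \<in> carrier T_geom \<Longrightarrow> t \<otimes>\<^bsub>T_geom\<^esub> (inv\<^bsub>T_geom\<^esub> t \<otimes>\<^bsub>T_geom\<^esub> u) = u"
  by (simp add: T.m_assoc[symmetric])

lemma image_pairs:
  assumes "\<And>t l. t \<in> A \<Longrightarrow> l \<in> B \<Longrightarrow> f (g t) l = k (m t l)"
  shows "{f u l | u l. u \<in> g ` A \<and> l \<in> B} = k ` {m t l | t l. t \<in> A \<and> l \<in> B}"
  using assms by (auto simp: image_iff) metis+

definition twist_class :: "nat \<Rightarrow> geom_transf set" where
  "twist_class k = {t \<in> T_geom'. twist (corner_part t) = k}"

lemma twist_class_nonempty:
  assumes "k < 3" shows "twist_class k \<noteq> {}"
proof -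
  let ?c = "(3, 3, 3) :: vec"
  let ?s = "corner_twist (\<lambda>c. if c = ?c then k else 0)"
  have "(edge_one, ?s, centre_one) \<in> T_geom'"
    unfolding centre_one_def by (rule edge_trivial_in_T_geom'[OF corner_twist_aut id_Bij])
  moreover have "twist ?s = k"
    using assms seed_pieces(8) by (simp add: twist_corner_twist)
  ultimately have "(edge_one, ?s, centre_one) \<in> twist_class k"
    by (simp add: twist_class_def corner_part_def)
  then show ?thesis by blast
qed

text \<open>Two centres of the face with normal \<open>basis E1\<close>, hence of the same colour in the solved state.\<close>

definition centre_swap :: "vec \<Rightarrow> vec" where
  "centre_swap = transpose (3, 1, 1) (3, 1, -1)"

definition swap_transf :: geom_transf where
  "swap_transf = (edge_one, corner_one, restrict centre_swap CentGeom)"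

lemma swap_pieces: "(3, 1, 1) \<in> CentGeom" "(3, 1, -1) \<in> CentGeom"
  unfolding CentGeom_list by code_simp+

lemma centre_swap_permutes: "centre_swap permutes CentGeom"
  unfolding centre_swap_def by (intro permutes_swap_id swap_pieces)

lemma swap_in_T_geom': "swap_transf \<in> T_geom'"
  unfolding swap_transf_def
  using permutes_imp_bij[OF centre_swap_permutes] corner_one_aut
  by (intro edge_trivial_in_T_geom') (simp_all add: Bij_def)

locale solved_colouring =
  fixes a b h
  assumes solved: "solved_state (a, b, h)"
begin

abbreviation "x0 \<equiv> (a, b, h)"

lemma a_iso: "a \<in> bundle_iso edge_geom edge_mat"
  and b_iso: "b \<in> bundle_iso corner_geom corner_mat"
  and h_bij: "bij_betw h CentGeom CentMat"
  and h_col: "(c, n) \<in> geom_facets CentGeom \<Longrightarrow> fst (h c) = col n"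
  using solved by (auto simp: solved_state_def Rev_marq_def split_beta)

lemma comp_geom_inj:
  assumes t: "t \<in> carrier T_geom" and u: "u \<in> carrier T_geom" and eq: "comp_geom x0 t = comp_geom x0 u"
  shows "t = u"
proof -
  obtain e s \<phi> e' s' \<phi>' where tu: "t = (e, s, \<phi>)" "u = (e', s', \<phi>')" by (metis prod.exhaust)
  have iso: "e \<in> bundle_iso edge_geom edge_geom" "e' \<in> bundle_iso edge_geom edge_geom"
    "s \<in> corner_aut" "s' \<in> corner_aut" "\<phi> \<in> Bij CentGeom" "\<phi>' \<in> Bij CentGeom"
    using t u by (auto simp: tu carrier_T_geom)
  have eqs: "bundle_comp edge_geom a e = bundle_comp edge_geom a e'"
    "bundle_comp corner_geom b s = bundle_comp corner_geom b s'"
    "compose CentGeom h \<phi> = compose CentGeom h \<phi>'"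
    using eq by (simp_all add: tu comp_geom_def)
  have "\<phi> c = \<phi>' c" if "c \<in> CentGeom" for c
  proof -
    have "h (\<phi> c) = h (\<phi>' c)" using fun_cong[OF eqs(3), of c] that by (simp add: compose_eq)
    moreover have "\<phi> c \<in> CentGeom" "\<phi>' c \<in> CentGeom"
      using iso(5,6) that by (auto simp: Bij_def dest: bij_betwE)
    ultimately show ?thesis using h_bij by (auto simp: bij_betw_def dest: inj_onD)
  qed
  then have "\<phi> = \<phi>'" using iso(5,6) by (intro extensionalityI[of _ CentGeom]) (auto simp: Bij_def)
  then show ?thesis
    using bundle_comp_cancel[OF a_iso iso(1,2) eqs(1)] bundle_comp_cancel[OF b_iso iso(3,4) eqs(2)] tu by simp
qed

lemma comp_geom_mult:
  assumes t: "t \<in> carrier T_geom" and u: "u \<in> carrier T_geom"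
  shows "comp_geom (comp_geom x0 t) u = comp_geom x0 (t \<otimes>\<^bsub>T_geom\<^esub> u)"
proof -
  obtain e s \<phi> e' s' \<phi>' where tu: "t = (e, s, \<phi>)" "u = (e', s', \<phi>')" by (metis prod.exhaust)
  have iso: "e' \<in> bundle_iso edge_geom edge_geom" "s' \<in> corner_aut" "\<phi> \<in> Bij CentGeom" "\<phi>' \<in> Bij CentGeom"
    using t u by (auto simp: tu carrier_T_geom)
  have "\<phi>' \<in> CentGeom \<rightarrow> CentGeom" using iso(4) by (rule Bij_imp_funcset)
  then show ?thesis
    using bundle_comp_assoc[OF iso(1), of a e] bundle_comp_assoc[OF iso(2), of b s] compose_assoc[of \<phi>' CentGeom CentGeom h \<phi>]
    by (simp add: tu comp_geom_def T_geom_mult iso)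
qed

definition conj_x0 :: "geom_transf \<Rightarrow> mat_transf" where
  "conj_x0 t = comp_mat (comp_geom x0 t) (state_inv x0)"

lemma comp_conj_x0:
  assumes t: "t \<in> carrier T_geom" and w: "w \<in> carrier T_geom"
  shows "comp_geom (conj_x0 t) (comp_geom x0 w) = comp_geom x0 (t \<otimes>\<^bsub>T_geom\<^esub> w)"
proof -
  obtain e s \<phi> e' s' \<phi>' where tw: "t = (e, s, \<phi>)" "w = (e', s', \<phi>')" by (metis prod.exhaust)
  have iso: "e \<in> bundle_iso edge_geom edge_geom" "e' \<in> bundle_iso edge_geom edge_geom"
    "s \<in> corner_aut" "s' \<in> corner_aut" "\<phi> \<in> Bij CentGeom" "\<phi>' \<in> Bij CentGeom"
    using t w by (auto simp: tw carrier_T_geom)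
  show ?thesis
    using bundle_conj_comp[OF bundle_closed_edge_geom a_iso iso(1,2)]
      bundle_conj_comp[OF bundle_closed_corner_geom b_iso iso(3,4)] compose_conj[OF h_bij iso(6), of \<phi>]
    by (simp add: conj_x0_def tw comp_geom_def comp_mat_def state_inv_def T_geom_mult iso(5,6))
qed

text \<open>The constrained indistinguishable transformations, carried to the geometric side by the
  solved state \<open>x0\<close>.\<close>

definition indist_geom :: "geom_transf set" where
  "indist_geom = {t \<in> T_geom'. conj_x0 t \<in> indist}"

lemma indist'_eq: "indist' x0 = conj_x0 ` indist_geom"
  by (auto simp: indist'_def indist_geom_def conj_x0_def)

lemma indist_geom_corner_part:
  assumes "t \<in> indist_geom" shows "corner_part t = corner_one"
proof -
  have t: "t \<in> carrier T_geom" using assms T_geom'_carrier by (simp add: indist_geom_def)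
  obtain e s \<phi> where tf: "t = (e, s, \<phi>)" by (metis prod.exhaust)
  have s: "s \<in> corner_aut" using t by (simp add: tf carrier_T_geom)
  have "bundle_comp corner_mat (bundle_comp corner_geom b s) (bundle_inv corner_geom corner_mat b)
    = (\<lambda>c\<in>pieces corner_mat. c, \<lambda>x\<in>facets corner_mat. x)"
    using assms by (simp add: indist_geom_def conj_x0_def tf comp_geom_def comp_mat_def state_inv_def indist_def bundle_aut_def)
  from bundle_conj_comp[OF bundle_closed_corner_geom b_iso s corner_one_aut, unfolded this]
  have "bundle_comp corner_geom b corner_one = bundle_comp corner_geom b s"
    using bundle_comp_one(1)[OF b_iso] bundle_comp_one(2)[OF b_iso] bundle_comp_one(2)[OF s]
    by (simp add: corner_one_def)
  then show ?thesis
    using bundle_comp_cancel[OF b_iso corner_one_aut s] by (simp add: tf corner_part_def)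
qed

lemma centre_only_in_indist_geom:
  assumes p: "p permutes CentGeom" and col: "\<And>c. c \<in> CentGeom \<Longrightarrow> fst (h (p c)) = fst (h c)"
  shows "(edge_one, corner_one, restrict p CentGeom) \<in> indist_geom"
proof -
  let ?k = "compose CentMat (compose CentGeom h (restrict p CentGeom)) (restrict (inv_into CentGeom h) CentMat)"
  have pB: "bij_betw p CentGeom CentGeom" using permutes_imp_bij[OF p] .
  have hinv: "bij_betw (inv_into CentGeom h) CentMat CentGeom" using h_bij by (rule bij_betw_inv_into)
  have "bij_betw ?k CentMat CentMat"
    using hinv pB h_bij by (intro bij_betw_compose[of _ _ CentGeom]) simp_all
  moreover have "fst (?k x) = fst x" if x: "x \<in> CentMat" for x
  proof -
    have "inv_into CentGeom h x \<in> CentGeom" "h (inv_into CentGeom h x) = x"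
      using hinv h_bij x by (auto dest: bij_betwE simp: bij_betw_inv_into_right)
    then show ?thesis using x col by (simp add: compose_eq)
  qed
  ultimately have k: "?k \<in> I_CentMat" by (simp add: I_CentMat_def BijGroup_def Bij_def)
  have "bundle_comp edge_mat (bundle_comp edge_geom a edge_one) (bundle_inv edge_geom edge_mat a)
    = (\<lambda>c\<in>pieces edge_mat. c, \<lambda>x\<in>facets edge_mat. x)"
    using bundle_comp_one(2)[OF a_iso] bundle_comp_inv(2)[OF a_iso] by (simp add: edge_one_def)
  moreover have "\<dots> \<in> I_ArMat"
    using bundle_one_iso[OF bundle_closed_edge_mat] by (simp add: I_ArMat_def bundle_aut_def)
  moreover have "bundle_comp corner_mat (bundle_comp corner_geom b corner_one) (bundle_inv corner_geom corner_mat b)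
    = \<one>\<^bsub>bundle_aut corner_mat\<^esub>"
    using bundle_comp_one(2)[OF b_iso] bundle_comp_inv(2)[OF b_iso] by (simp add: corner_one_def bundle_aut_def)
  ultimately have "conj_x0 (edge_one, corner_one, restrict p CentGeom) \<in> indist"
    using k by (simp add: conj_x0_def comp_geom_def comp_mat_def state_inv_def indist_def)
  then show ?thesis
    using edge_trivial_in_T_geom'[OF corner_one_aut, of "restrict p CentGeom"] pB by (simp add: indist_geom_def Bij_def)
qed

lemma one_in_indist_geom: "\<one>\<^bsub>T_geom\<^esub> \<in> indist_geom"
  using centre_only_in_indist_geom[OF permutes_id] by (simp add: T_geom_one centre_one_def id_def)

lemma swap_in_indist_geom: "swap_transf \<in> indist_geom"
  unfolding swap_transf_def
proof (rule centre_only_in_indist_geom[OF centre_swap_permutes])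
  have "((3, 1, 1), (1, 0, 0)) \<in> geom_facets CentGeom" "((3, 1, -1), (1, 0, 0)) \<in> geom_facets CentGeom"
    using swap_pieces by (simp_all add: geom_facets_iff normal_list_def)
  then have "fst (h (3, 1, 1)) = fst (h (3, 1, -1))" using h_col by metis
  then show "fst (h (centre_swap c)) = fst (h c)" for c by (simp add: centre_swap_def transpose_def)
qed

text \<open>If \<open>u\<close> is odd on the centres, replacing it by the product of \<open>w\<^sup>-\<^sup>1 j\<^sup>-\<^sup>1 w\<close> with \<open>u\<close>, for \<open>j\<close> the exchange of two centres of
  the same colour, makes it even.\<close>

lemma fix_centre_parity:
  assumes w: "w \<in> T_geom'" and u: "u \<in> T_geom'" "corner_part u = corner_one"
  obtains j v where "j \<in> indist_geom" "v \<in> legal" "j \<otimes>\<^bsub>T_geom\<^esub> w \<otimes>\<^bsub>T_geom\<^esub> v = w \<otimes>\<^bsub>T_geom\<^esub> u"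
proof -
  have c: "w \<in> carrier T_geom" "u \<in> carrier T_geom" "swap_transf \<in> carrier T_geom"
    using w u swap_in_T_geom' T_geom'_carrier by auto
  obtain q where q: "q permutes CentGeom" "centre_part u = restrict q CentGeom"
    using Bij_permutes parts_carrier(4)[OF c(2)] by blast
  obtain \<omega> where \<omega>: "\<omega> permutes CentGeom" "centre_part w = restrict \<omega> CentGeom"
    using Bij_permutes parts_carrier(4)[OF c(1)] by blast
  show thesis
  proof (cases "evenperm q")
    case True
    then have "u \<in> legal" using even_centres_legal u q by (simp add: one_parts)
    then show ?thesis using that[OF one_in_indist_geom] c by simp
  next
    case False
    let ?j = swap_transf
    let ?i = "inv\<^bsub>T_geom\<^esub> w \<otimes>\<^bsub>T_geom\<^esub> inv\<^bsub>T_geom\<^esub> ?j \<otimes>\<^bsub>T_geom\<^esub> w"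
    let ?v = "?i \<otimes>\<^bsub>T_geom\<^esub> u"
    have i: "?i \<in> T_geom'" "?v \<in> T_geom'"
      using w u swap_in_T_geom' T_geom'_mult T_geom'_inv by auto
    have ic: "?i \<in> carrier T_geom" "?v \<in> carrier T_geom" using i T_geom'_carrier by auto
    have jwv: "?j \<otimes>\<^bsub>T_geom\<^esub> w \<otimes>\<^bsub>T_geom\<^esub> ?v = w \<otimes>\<^bsub>T_geom\<^esub> u"
      using c by (simp add: T.m_assoc T_cancel_inv)
    have js: "corner_part ?j = corner_one" by (simp add: swap_transf_def corner_part_def)
    have "corner_part (inv\<^bsub>T_geom\<^esub> ?j) = corner_part \<one>\<^bsub>T_geom\<^esub>"
    proof -
      have "bundle_comp corner_geom (corner_part (inv\<^bsub>T_geom\<^esub> ?j)) corner_one = corner_one"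
        using mult_parts(2)[OF T.inv_closed[OF c(3)] c(3)] c(3) js by (simp add: one_parts)
      then show ?thesis
        using bundle_comp_one(2)[OF parts_carrier(2)[of "inv\<^bsub>T_geom\<^esub> ?j"]] c by (simp add: one_parts corner_one_def)
    qed
    then have "corner_part ?i = corner_part \<one>\<^bsub>T_geom\<^esub>"
      using corner_kernel_conj[of "inv\<^bsub>T_geom\<^esub> w" "inv\<^bsub>T_geom\<^esub> ?j"] c by simp
    then have vc: "corner_part ?v = corner_part \<one>\<^bsub>T_geom\<^esub>"
      using corner_kernel_mult[OF ic(1) c(2)] u by (simp add: one_parts)
    obtain r where r: "r permutes CentGeom" "centre_part ?v = restrict r CentGeom"
      using Bij_permutes parts_carrier(4)[OF ic(2)] by blast
    have jc: "centre_part ?j = restrict centre_swap CentGeom" by (simp add: swap_transf_def centre_part_def)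
    have P: "centre_swap \<circ> \<omega> permutes CentGeom" "centre_swap \<circ> \<omega> \<circ> r permutes CentGeom" "\<omega> \<circ> q permutes CentGeom"
      by (intro permutes_compose centre_swap_permutes \<omega>(1) q(1) r(1))+
    have "restrict (centre_swap \<circ> \<omega> \<circ> r) CentGeom = restrict (\<omega> \<circ> q) CentGeom"
      using arg_cong[OF jwv, of centre_part] c ic(2)
      by (simp only: mult_parts T.m_closed jc \<omega>(2) q(2) r(2) restrict_permutes_comp \<omega>(1) q(1) r(1))
    then have eq: "centre_swap \<circ> \<omega> \<circ> r = \<omega> \<circ> q"
      using permutes_restrict_eq[OF P(2,3)] by simp
    have odd: "\<not> evenperm centre_swap" by (simp add: centre_swap_def evenperm_swap)
    have "evenperm r"
      using evenperm_comp_on[OF finite_pieces(3) P(1) r(1)] evenperm_comp_on[OF finite_pieces(3) \<omega>(1) q(1)]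
        evenperm_comp_on[OF finite_pieces(3) centre_swap_permutes \<omega>(1)] False odd unfolding eq by blast
    then have "?v \<in> legal" using even_centres_legal[OF i(2) vc r] by blast
    then show ?thesis using that[OF swap_in_indist_geom _ jwv] by blast
  qed
qed

text \<open>As the twist takes values in an abelian group, all \<open>t w l\<close> share the twist of \<open>w\<close>. The converse
  inclusion first settles the corners by a legal move, then the parity of the centres.\<close>

lemma double_coset:
  assumes w: "w \<in> T_geom'"
  shows "{t \<otimes>\<^bsub>T_geom\<^esub> w \<otimes>\<^bsub>T_geom\<^esub> l | t l. t \<in> indist_geom \<and> l \<in> legal} = twist_class (twist (corner_part w))"
    (is "?D = ?C")
proof
  have wc: "w \<in> carrier T_geom" using w T_geom'_carrier by blast
  show "?D \<subseteq> ?C"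
  proof
    fix s assume "s \<in> ?D"
    then obtain t l where tl: "s = t \<otimes>\<^bsub>T_geom\<^esub> w \<otimes>\<^bsub>T_geom\<^esub> l" "t \<in> indist_geom" "l \<in> legal" by blast
    have t: "t \<in> T_geom'" "corner_part t = corner_one" using tl(2) indist_geom_corner_part by (auto simp: indist_geom_def)
    have c: "t \<in> carrier T_geom" "l \<in> carrier T_geom" using t tl(3) T_geom'_carrier legal_carrier by auto
    have "s \<in> T_geom'" using tl t w T_geom'_mult legal_subset_T_geom' by blast
    moreover have "twist (corner_part s) = twist (corner_part w)"
      using c wc twist_less[of "corner_part w"]
      by (simp add: tl(1) twist_mult twist_legal[OF tl(3)] t(2) twist_one)
    ultimately show "s \<in> ?C" by (simp add: twist_class_def)
  qed
  show "?C \<subseteq> ?D"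
  proof
    fix s assume "s \<in> ?C"
    then have s: "s \<in> T_geom'" "twist (corner_part s) = twist (corner_part w)" by (auto simp: twist_class_def)
    have sc: "s \<in> carrier T_geom" using s T_geom'_carrier by blast
    let ?r = "inv\<^bsub>T_geom\<^esub> w \<otimes>\<^bsub>T_geom\<^esub> s"
    have r: "?r \<in> T_geom'" using T_geom'_mult T_geom'_inv w s by blast
    then have rc: "?r \<in> carrier T_geom" by (rule T_geom'_carrier)
    have "twist (corner_part ?r) = 0"
      using twist_mult[OF T.inv_closed[OF wc] sc] twist_inv[OF wc] s(2) by simp
    then obtain l where l: "l \<in> legal" "corner_part l = corner_part ?r"
      using legal_corner_part parts_carrier(2)[OF rc] by metis
    have lc: "l \<in> carrier T_geom" using l legal_carrier by blast
    let ?u = "?r \<otimes>\<^bsub>T_geom\<^esub> inv\<^bsub>T_geom\<^esub> l"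
    have u: "?u \<in> T_geom'" using r l legal_inv legal_subset_T_geom' T_geom'_mult by blast
    have "corner_part ?u = corner_part (l \<otimes>\<^bsub>T_geom\<^esub> inv\<^bsub>T_geom\<^esub> l)"
      using mult_parts(2)[OF rc T.inv_closed[OF lc]] mult_parts(2)[OF lc T.inv_closed[OF lc]] l(2) by simp
    then have "corner_part ?u = corner_one" using lc by (simp add: one_parts)
    then obtain j v where jv: "j \<in> indist_geom" "v \<in> legal" "j \<otimes>\<^bsub>T_geom\<^esub> w \<otimes>\<^bsub>T_geom\<^esub> v = w \<otimes>\<^bsub>T_geom\<^esub> ?u"
      using fix_centre_parity[OF w u] by blast
    have c: "j \<in> carrier T_geom" "v \<in> carrier T_geom" "?u \<in> carrier T_geom"
      using jv u T_geom'_carrier legal_carrier by (auto simp: indist_geom_def)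
    have "s = w \<otimes>\<^bsub>T_geom\<^esub> ?u \<otimes>\<^bsub>T_geom\<^esub> l" using wc sc lc by (simp add: T.m_assoc T_cancel_inv)
    also have "\<dots> = j \<otimes>\<^bsub>T_geom\<^esub> w \<otimes>\<^bsub>T_geom\<^esub> (v \<otimes>\<^bsub>T_geom\<^esub> l)"
      using jv(3)[symmetric] c wc lc by (simp add: T.m_assoc)
    finally show "s \<in> ?D" using jv(1) legal_mult[OF jv(2) l(1)] by blast
  qed
qed

lemma double_orbit_eq:
  assumes w: "w \<in> T_geom'"
  shows "double_orbit x0 (comp_geom x0 w) = comp_geom x0 ` twist_class (twist (corner_part w))"
proof -
  have wc: "w \<in> carrier T_geom" using w T_geom'_carrier by blast
  have "comp_geom (comp_geom (conj_x0 t) (comp_geom x0 w)) l = comp_geom x0 (t \<otimes>\<^bsub>T_geom\<^esub> w \<otimes>\<^bsub>T_geom\<^esub> l)"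
    if "t \<in> indist_geom" "l \<in> legal" for t l
    using that wc T_geom'_carrier[of t] legal_carrier by (simp add: indist_geom_def comp_conj_x0 comp_geom_mult)
  then have "double_orbit x0 (comp_geom x0 w)
    = comp_geom x0 ` {t \<otimes>\<^bsub>T_geom\<^esub> w \<otimes>\<^bsub>T_geom\<^esub> l | t l. t \<in> indist_geom \<and> l \<in> legal}"
    unfolding double_orbit_def indist'_eq by (rule image_pairs)
  then show ?thesis by (simp only: double_coset[OF w])
qed

theorem card_Ineq_meca: "card (Ineq_meca x0) = 3"
proof -
  let ?O = "\<lambda>k. comp_geom x0 ` twist_class k"
  have "Ineq_meca x0 = {double_orbit x0 (comp_geom x0 w) | w. w \<in> T_geom'}"
    unfolding Ineq_meca_def Rev_meca_def by blast
  also have "\<dots> = {?O (twist (corner_part w)) | w. w \<in> T_geom'}"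
    by (rule Collect_cong) (metis double_orbit_eq)
  also have "\<dots> = ?O ` {..<3}"
  proof
    show "{?O (twist (corner_part w)) | w. w \<in> T_geom'} \<subseteq> ?O ` {..<3}"
      using twist_less by blast
    show "?O ` {..<3} \<subseteq> {?O (twist (corner_part w)) | w. w \<in> T_geom'}"
    proof
      fix Y assume "Y \<in> ?O ` {..<3}"
      then obtain k where k: "k < 3" "Y = ?O k" by blast
      obtain w where "w \<in> twist_class k" using twist_class_nonempty[OF k(1)] by blast
      then show "Y \<in> {?O (twist (corner_part w)) | w. w \<in> T_geom'}"
        using k(2) unfolding twist_class_def by blast
    qed
  qed
  finally have eq: "Ineq_meca x0 = ?O ` {..<3}" .
  have "inj_on ?O {..<3}"
  proof (rule inj_onI)
    fix k m assume km: "k \<in> {..<3}" "m \<in> {..<3}" "?O k = ?O m"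
    obtain w where w: "w \<in> twist_class k" using twist_class_nonempty km(1) by blast
    then obtain v where v: "v \<in> twist_class m" "comp_geom x0 w = comp_geom x0 v" using km(3) by blast
    then have "w = v" using w comp_geom_inj T_geom'_carrier by (simp add: twist_class_def)
    then show "k = m" using w v by (simp add: twist_class_def)
  qed
  then show ?thesis by (simp add: eq card_image)
qed

end

theorem mainTheorem3:
  fixes x0 :: state
  assumes "solved_state x0"
  shows "card (Ineq_meca x0) = 3"
proof -
  obtain a b h where x0: "x0 = (a, b, h)" by (metis prod.exhaust)
  interpret solved_colouring a b h by standard (use assms x0 in simp)
  show ?thesis unfolding x0 by (rule card_Ineq_meca)
qed

end
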